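(* CWCM with top-truncated votes for the maximin rule is solvable in polynomial time, for any number of candidates (the number of candidates is not bounded and is part of the input).
   Context: An election has a finite set $C$ of candidates and voters with non-negative integer weights (encoded in binary); a vote of weight $w$ counts as $w$ identical votes. A top-truncated vote is a linear order over a non-empty subset of $C$; the unranked candidates are regarded as tied with each other and below all ranked ones. A complete vote ranks all of $C$ and is a special case. Maximin: let $N_P(c_i,c_j)$ be the (weighted) number of voters who strictly prefer $c_i$ to $c_j$ in the profile $P$. The score of $c_i$ is $\min_{j\ne i}N_P(c_i,c_j)$, and the winners are the candidates with highest score. CWCM (Constructive Weighted Coalitional Manipulation) with top-truncated votes: given a set $S$ of weighted votes of the non-manipulators (possibly top-truncated), the weights of a set $T$ of manipulators' votes, and a preferred candidate $p$, decide whether the votes in $T$ can be cast (each as an arbitrary top-truncated or complete vote) so that $p$ is a winner (not necessarily unique) of the election with votes $S\cup T$. *)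

theory Defs
  imports "HOL-Computational_Algebra.Polynomial"
begin

section \<open>Deterministic polynomial time\<close>

text \<open>
  Deterministic multitape Turing machines. States are the numbers below \<open>states\<close>, tape symbols the
  numbers below \<open>symbols\<close>; symbol 0 is the blank, and 1 and 2 stand for the input bits \<open>False\<close> and
  \<open>True\<close>. Every tape is infinite in both directions.
\<close>

datatype direction = Move_Left | Stay | Move_Right

type_synonym tape = "(int \<Rightarrow> nat) \<times> int"

record machine =
  tapes :: nat
  states :: nat
  symbols :: nat
  start :: nat
  accept :: nat
  reject :: nat
  delta :: "nat \<Rightarrow> nat list \<Rightarrow> nat \<times> (nat \<times> direction) list"

definition turing_machine :: "machine \<Rightarrow> bool" where
  "turing_machine M \<longleftrightarrow>
     1 \<le> tapes M \<and> 3 \<le> symbols M \<and>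
     start M < states M \<and> accept M < states M \<and> reject M < states M \<and> accept M \<noteq> reject M \<and>
     (\<forall>q ss q' as.
        q < states M \<and> length ss = tapes M \<and> set ss \<subseteq> {..<symbols M} \<and> delta M q ss = (q', as) \<longrightarrow>
        q' < states M \<and> length as = tapes M \<and> fst ` set as \<subseteq> {..<symbols M})"

fun offset :: "direction \<Rightarrow> int" where
  "offset Move_Left = - 1"
| "offset Stay = 0"
| "offset Move_Right = 1"

fun scanned :: "tape \<Rightarrow> nat" where
  "scanned (cells, pos) = cells pos"

fun act :: "nat \<times> direction \<Rightarrow> tape \<Rightarrow> tape" where
  "act (s, d) (cells, pos) = (cells(pos := s), pos + offset d)"

text \<open>
  Configurations in the accepting or rejecting state are fixed points, so being in such a state
  after exactly \<open>t\<close> iterations means having halted there within \<open>t\<close> steps.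
\<close>

fun step :: "machine \<Rightarrow> nat \<times> tape list \<Rightarrow> nat \<times> tape list" where
  "step M (q, ts) =
     (if q = accept M \<or> q = reject M then (q, ts)
      else let (q', as) = delta M q (map scanned ts) in (q', map2 act as ts))"

definition blank_tape :: tape where
  "blank_tape = ((\<lambda>_. 0), 0)"

definition input_tape :: "bool list \<Rightarrow> tape" where
  "input_tape x =
     ((\<lambda>i. if 0 \<le> i \<and> i < int (length x) then if x ! nat i then 2 else 1 else 0), 0)"

definition initial :: "machine \<Rightarrow> bool list \<Rightarrow> nat \<times> tape list" where
  "initial M x = (start M, input_tape x # replicate (tapes M - 1) blank_tape)"

definition decides_within :: "machine \<Rightarrow> bool list set \<Rightarrow> (nat \<Rightarrow> nat) \<Rightarrow> bool" where
  "decides_within M L time \<longleftrightarrow>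
     (\<forall>x. fst ((step M ^^ time (length x)) (initial M x)) = (if x \<in> L then accept M else reject M))"

definition PTIME :: "bool list set set" where
  "PTIME = {L. \<exists>M (p :: nat poly). turing_machine M \<and> decides_within M L (poly p)}"


section \<open>Elections and the maximin rule\<close>

text \<open>
  A top-truncated vote is the list of its ranked candidates, best first; a complete vote is one
  whose list contains all candidates.
\<close>

type_synonym ranking = "nat list"
type_synonym profile = "(nat \<times> ranking) list"  \<comment> \<open>weights paired with votes\<close>

definition top_truncated :: "nat set \<Rightarrow> ranking \<Rightarrow> bool" where
  "top_truncated C r \<longleftrightarrow> r \<noteq> [] \<and> distinct r \<and> set r \<subseteq> C"

text \<open>An unranked \<open>b\<close> satisfies the inner condition vacuously, so it is below every ranked candidate.\<close>

definition prefers :: "ranking \<Rightarrow> nat \<Rightarrow> nat \<Rightarrow> bool" where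
  "prefers r a b \<longleftrightarrow> (\<exists>i<length r. r ! i = a \<and> (\<forall>j<length r. r ! j = b \<longrightarrow> i < j))"

definition support :: "profile \<Rightarrow> nat \<Rightarrow> nat \<Rightarrow> nat" where
  "support P a b = (\<Sum>(w, r)\<leftarrow>P. if prefers r a b then w else 0)"

definition maximin_score :: "nat set \<Rightarrow> profile \<Rightarrow> nat \<Rightarrow> nat" where
  "maximin_score C P a = Min (support P a ` (C - {a}))"

text \<open>
  With a single candidate the score is a minimum over the empty set, hence unspecified; that
  candidate is the winner whatever the value.
\<close>

definition maximin_winners :: "nat set \<Rightarrow> profile \<Rightarrow> nat set" where
  "maximin_winners C P = {a \<in> C. \<forall>b\<in>C. maximin_score C P b \<le> maximin_score C P a}"


section \<open>Constructive weighted coalitional manipulation\<close>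

record cwcm =
  candidates :: "nat list"
  nonmanipulators :: profile
  weights :: "nat list"  \<comment> \<open>of the manipulators\<close>
  preferred :: nat

definition cwcm_instance :: "cwcm \<Rightarrow> bool" where
  "cwcm_instance I \<longleftrightarrow>
     distinct (candidates I) \<and>
     (\<forall>(w, r) \<in> set (nonmanipulators I). top_truncated (set (candidates I)) r) \<and>
     preferred I \<in> set (candidates I)"

definition maximin_manipulable :: "cwcm \<Rightarrow> bool" where
  "maximin_manipulable I \<longleftrightarrow>
     (\<exists>rs. length rs = length (weights I) \<and>
           (\<forall>r\<in>set rs. top_truncated (set (candidates I)) r) \<and>
           preferred I \<in> maximin_winners (set (candidates I)) (nonmanipulators I @ zip (weights I) rs))"


section \<open>Instances as bit strings\<close>

text \<open>Binary expansion, least significant bit first and without leading zeros.\<close>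

fun bits :: "nat \<Rightarrow> bool list" where
  "bits n = (if n = 0 then [] else odd n # bits (n div 2))"

declare bits.simps [simp del]

text \<open>Every list element is announced by \<open>True\<close> and the end of the list by \<open>False\<close>.\<close>

definition enc_list :: "('a \<Rightarrow> bool list) \<Rightarrow> 'a list \<Rightarrow> bool list" where
  "enc_list f xs = concat (map (\<lambda>x. True # f x) xs) @ [False]"

definition enc_nat :: "nat \<Rightarrow> bool list" where
  "enc_nat n = enc_list (\<lambda>b. [b]) (bits n)"

definition enc_vote :: "nat \<times> ranking \<Rightarrow> bool list" where
  "enc_vote v = enc_nat (fst v) @ enc_list enc_nat (snd v)"

definition enc_cwcm :: "cwcm \<Rightarrow> bool list" where
  "enc_cwcm I =
     enc_list enc_nat (candidates I) @ enc_list enc_vote (nonmanipulators I) @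
     enc_list enc_nat (weights I) @ enc_nat (preferred I)"

text \<open>The encoding is injective, so membership in the language below is a property of the instance.\<close>

definition self_delimiting :: "('a \<Rightarrow> bool list) \<Rightarrow> bool" where
  "self_delimiting f \<longleftrightarrow> (\<forall>x y u v. f x @ u = f y @ v \<longrightarrow> x = y \<and> u = v)"

lemma self_delimitingD: "self_delimiting f \<Longrightarrow> f x @ u = f y @ v \<longleftrightarrow> x = y \<and> u = v"
  unfolding self_delimiting_def by blast

lemma self_delimiting_enc_list:
  assumes "self_delimiting f"
  shows "self_delimiting (enc_list f)"
proof -
  have "xs = ys \<and> u = v" if "enc_list f xs @ u = enc_list f ys @ v" for xs ys u v
    using that
  proof (induction xs arbitrary: ys)
    case Nil
    then show ?case by (cases ys) (auto simp: enc_list_def)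
  next
    case (Cons x xs)
    then show ?case
      by (cases ys) (auto simp: enc_list_def self_delimitingD[OF assms])
  qed
  then show ?thesis unfolding self_delimiting_def by blast
qed

lemma bits_inject: "bits m = bits n \<Longrightarrow> m = n"
proof (induction m arbitrary: n rule: less_induct)
  case (less m)
  show ?case
  proof (cases "m = 0 \<or> n = 0")
    case True
    then show ?thesis using less.prems by (auto simp: bits.simps[of m] bits.simps[of n] split: if_splits)
  next
    case False
    then have eq: "odd m = odd n" "bits (m div 2) = bits (n div 2)"
      using less.prems by (auto simp: bits.simps[of m] bits.simps[of n])
    then have "m div 2 = n div 2" using less.IH[of "m div 2" "n div 2"] False by simp
    moreover have "m mod 2 = n mod 2" using eq(1) by (simp add: mod2_eq_if)
    ultimately show ?thesis by (metis div_mult_mod_eq)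
  qed
qed

lemma self_delimiting_enc_nat: "self_delimiting enc_nat"
proof -
  have "self_delimiting (\<lambda>b. [b])" by (simp add: self_delimiting_def)
  note D = self_delimitingD[OF self_delimiting_enc_list[OF this]]
  have "m = n \<and> u = v" if "enc_nat m @ u = enc_nat n @ v" for m n u v
    using that unfolding enc_nat_def D by (auto dest: bits_inject)
  then show ?thesis unfolding self_delimiting_def by blast
qed

lemma self_delimiting_enc_vote: "self_delimiting enc_vote"
  unfolding self_delimiting_def enc_vote_def
  by (simp add: self_delimitingD[OF self_delimiting_enc_nat] prod_eq_iff
      self_delimitingD[OF self_delimiting_enc_list[OF self_delimiting_enc_nat]])

lemma inj_enc_cwcm: "inj enc_cwcm"
proof (rule injI)
  fix I J :: cwcm
  assume "enc_cwcm I = enc_cwcm J"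
  then have "enc_cwcm I @ [] = enc_cwcm J @ []" by simp
  then show "I = J"
    unfolding enc_cwcm_def append_assoc
    by (simp only: self_delimitingD[OF self_delimiting_enc_nat]
        self_delimitingD[OF self_delimiting_enc_list[OF self_delimiting_enc_nat]]
        self_delimitingD[OF self_delimiting_enc_list[OF self_delimiting_enc_vote]]) simp
qed

definition CWCM_maximin :: "bool list set" where
  "CWCM_maximin = enc_cwcm ` {I. cwcm_instance I \<and> maximin_manipulable I}"

end

theory Submission
  imports Defs
begin

text \<open>
  A ballot ranking only the preferred candidate \<open>p\<close> raises the score of \<open>p\<close> as much as any ballot
  can and raises no other score. So all manipulators may cast it, and the question becomes whether
  every rival \<open>b\<close> has, for each candidate \<open>c\<close> met by \<open>p\<close>, an opponent \<open>d\<close> such that the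
  non-manipulators' support of \<open>b\<close> against \<open>d\<close> is at most that of \<open>p\<close> against \<open>c\<close> plus the total
  weight of the manipulators.

  This is decidable with logarithmic work space: a fixed number of two-way read heads on the input
  suffices, each acting as a counter bounded by the input length. Nested loops over such counters
  parse the input, and comparing two sums of binary weights needs only one running carry, which is
  bounded by the number of summands.
\<close>

section \<open>Programs for read-only heads and their compilation\<close>

text \<open>\<open>PTIME\<close> speaks of concrete machines, so the algorithm has to become a
  transition table. The intermediate programs never write: a register is a head on its own copy of
  the input, its value lies between 0 and \<open>length x + 1\<close>, and this range is what bounds
  every loop polynomially. The price is that weights, candidate names and sums of weights do not fit
  into a register in general. Names are compared digit by digit, weights are read one column at a
  time, and counting saturates at \<open>length x + 1\<close>. That no counter saturates on a real
  instance has to be proved: \<open>length_enc_cwcm\<close> shows the encoding to be long enough for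
  carry plus column sum. Comparing sums by subtraction would need a signed carry. Replacing each
  subtracted w by 2^k - w leaves only additions, and the total is then compared with 2^k times the
  number of subtracted weights. Time bounds hold on every bit string, whereas the winner test is
  shown correct only on encoded instances. Hence the parsers are total, with position 0 as an
  absorbing failure value, and are also shown to succeed on nothing but encodings.\<close>

datatype com =
  Skip
| Inc nat
| Dec nat
| Seq com com
| Branch nat "nat \<Rightarrow> bool" com com
| Loop nat "nat \<Rightarrow> bool" com

fun regs :: "com \<Rightarrow> nat set" where
  "regs Skip = {}"
| "regs (Inc v) = {v}"
| "regs (Dec v) = {v}"
| "regs (Seq a b) = regs a \<union> regs b"
| "regs (Branch v S a b) = insert v (regs a \<union> regs b)"
| "regs (Loop v S a) = insert v (regs a)"

lemma finite_regs: "finite (regs c)"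
  by (induction c) auto

text \<open>The symbol 3 is a left end marker in cell 0, so value 0 of a register can be recognised
  by its scanned symbol, just as the blank recognises \<open>length x + 1\<close>.\<close>

definition symb :: "bool list \<Rightarrow> nat \<Rightarrow> nat" where
  "symb x v = (if v = 0 then 3 else if v \<le> length x then if x ! (v - 1) then 2 else 1 else 0)"

lemma symb_eq_iff [simp]:
  "symb x v = 0 \<longleftrightarrow> length x < v" "symb x v = 3 \<longleftrightarrow> v = 0"
  by (auto simp: symb_def)

text \<open>The list is a stack of commands still to be run. Only scanned symbols are passed in,
  never positions, so that this is a legitimate transition function. \<open>Inc\<close> is blocked
  on the blank and \<open>Dec\<close> on the marker, which confines every head to 0, ...,
  \<open>length x + 1\<close>.\<close>

fun ctl :: "com list \<Rightarrow> (nat \<Rightarrow> nat) \<Rightarrow> com list \<times> (nat \<Rightarrow> direction)" where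
  "ctl [] y = ([], \<lambda>_. Stay)"
| "ctl (Skip # K) y = (K, \<lambda>_. Stay)"
| "ctl (Inc v # K) y = (K, (\<lambda>_. Stay)(v := if y v = 0 then Stay else Move_Right))"
| "ctl (Dec v # K) y = (K, (\<lambda>_. Stay)(v := if y v = 3 then Stay else Move_Left))"
| "ctl (Seq a b # K) y = (a # b # K, \<lambda>_. Stay)"
| "ctl (Branch v S a b # K) y = ((if S (y v) then a else b) # K, \<lambda>_. Stay)"
| "ctl (Loop v S a # K) y = ((if S (y v) then a # Loop v S a # K else K), \<lambda>_. Stay)"

text \<open>A store is a function on all of \<open>nat\<close>, but the machine has only
  \<open>k\<close> work tapes; this lets the remaining registers be ignored.\<close>

lemma ctl_cong:
  assumes "\<And>i. i \<in> \<Union> (regs ` set K) \<Longrightarrow> y i = y' i"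
  shows "ctl K y = ctl K y'"
  proof (cases K)
  case (Cons a L)
  then show ?thesis using assms by (cases a) auto
qed simp

text \<open>No head leaves the marker to the left, so the conversion by \<open>nat\<close> in
  \<open>sstep\<close> never truncates.\<close>

lemma ctl_Move_Left: "snd (ctl K y) i = Move_Left \<Longrightarrow> y i \<noteq> 3"
  by (induction K y rule: ctl.induct) (auto split: if_splits)

definition sstep :: "bool list \<Rightarrow> com list \<times> (nat \<Rightarrow> nat) \<Rightarrow> com list \<times> (nat \<Rightarrow> nat)" where
  "sstep x = (\<lambda>(K, s). (fst (ctl K (symb x \<circ> s)),
     \<lambda>i. nat (int (s i) + offset (snd (ctl K (symb x \<circ> s)) i))))"

text \<open>Quantifying over the rest \<open>K\<close> of the stack makes runs compose: a command
  can be analysed without knowing what follows it.\<close>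

definition run :: "bool list \<Rightarrow> com \<Rightarrow> (nat \<Rightarrow> nat) \<Rightarrow> nat \<Rightarrow> (nat \<Rightarrow> nat) \<Rightarrow> bool" where
  "run x c s t s' \<longleftrightarrow> (\<forall>K. (sstep x ^^ t) (c # K, s) = (K, s'))"

lemma sstep_Nil: "sstep x ([], s) = ([], s)"
  by (simp add: sstep_def)

lemma funpow_sstep_Nil: "(sstep x ^^ t) ([], s) = ([], s)"
  by (induction t) (auto simp: sstep_Nil)

lemma run_Skip: "run x Skip s 1 s"
  by (simp add: run_def sstep_def)

lemma run_Inc: "run x (Inc v) s 1 (s(v := if s v \<le> length x then Suc (s v) else s v))"
  by (auto simp: run_def sstep_def fun_eq_iff)

lemma run_Dec: "run x (Dec v) s 1 (s(v := s v - 1))"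
  by (auto simp: run_def sstep_def fun_eq_iff)

lemma run_Seq:
  assumes "run x a s t s1" "run x b s1 u s2"
  shows "run x (Seq a b) s (Suc (t + u)) s2"
proof -
  have "(sstep x ^^ Suc (t + u)) (Seq a b # K, s) = (K, s2)" for K
  proof -
    have "sstep x (Seq a b # K, s) = (a # b # K, s)" by (simp add: sstep_def)
    then have "(sstep x ^^ Suc (t + u)) (Seq a b # K, s) = (sstep x ^^ (u + t)) (a # b # K, s)"
      by (simp only: funpow_Suc_right comp_apply add.commute)
    also have "\<dots> = (K, s2)" using assms by (simp add: funpow_add run_def)
    finally show ?thesis .
  qed
  then show ?thesis by (simp add: run_def)
qed

lemma run_Branch:
  assumes "run x (if S (symb x (s v)) then a else b) s t s'"
  shows "run x (Branch v S a b) s (Suc t) s'"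
proof -
  have "sstep x (Branch v S a b # K, s) = ((if S (symb x (s v)) then a else b) # K, s)" for K
    by (simp add: sstep_def)
  then show ?thesis using assms by (simp only: run_def funpow_Suc_right comp_apply simp_thms)
qed

lemma run_Loop_exit:
  assumes "\<not> S (symb x (s v))"
  shows "run x (Loop v S a) s 1 s"
  using assms by (simp add: run_def sstep_def)

lemma run_Loop_step:
  assumes "S (symb x (s v))" "run x a s t s1" "run x (Loop v S a) s1 u s2"
  shows "run x (Loop v S a) s (Suc (t + u)) s2"
proof -
  have "(sstep x ^^ Suc (t + u)) (Loop v S a # K, s) = (K, s2)" for K
  proof -
    have "sstep x (Loop v S a # K, s) = (a # Loop v S a # K, s)"
      using assms(1) by (simp add: sstep_def)
    then have "(sstep x ^^ Suc (t + u)) (Loop v S a # K, s)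
        = (sstep x ^^ (u + t)) (a # Loop v S a # K, s)"
      by (simp only: funpow_Suc_right comp_apply add.commute)
    also have "\<dots> = (K, s2)" using assms by (simp add: funpow_add run_def)
    finally show ?thesis .
  qed
  then show ?thesis by (simp add: run_def)
qed

section \<open>Finitely many control stacks\<close>

text \<open>An over-approximation of the stacks that occur while a command runs above
  \<open>K\<close>. The body of a loop is entered with that same loop on top of \<open>K\<close>, so
  the recursion is structural and the set finite, however often the loop is repeated.\<close>

fun reach :: "com \<Rightarrow> com list \<Rightarrow> com list set" where
  "reach Skip K = {Skip # K}"
| "reach (Inc v) K = {Inc v # K}"
| "reach (Dec v) K = {Dec v # K}"
| "reach (Seq a b) K = insert (Seq a b # K) (reach a (b # K) \<union> reach b K)"
| "reach (Branch v S a b) K = insert (Branch v S a b # K) (reach a K \<union> reach b K)"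
| "reach (Loop v S a) K = insert (Loop v S a # K) (reach a (Loop v S a # K))"

lemma finite_reach: "finite (reach c K)"
  by (induction c K rule: reach.induct) auto

lemma reach_self: "c # K \<in> reach c K"
  by (cases c) auto

lemma reach_ctl: "L \<in> reach c K \<Longrightarrow> fst (ctl L y) \<in> insert K (reach c K)"
proof (induction c K rule: reach.induct)
  case (4 a b K)
  then show ?case using reach_self[of a "b # K"] reach_self[of b K] by auto
next
  case (5 v S a b K)
  then show ?case using reach_self[of a K] reach_self[of b K] by auto
next
  case (6 v S a K)
  then show ?case using reach_self[of a "Loop v S a # K"] by (auto split: if_splits)
qed auto

lemma reach_regs: "L \<in> reach c K \<Longrightarrow> \<Union> (regs ` set L) \<subseteq> regs c \<union> \<Union> (regs ` set K)"
  by (induction c K rule: reach.induct) fastforce+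

text \<open>These stacks become machine states; the empty one means that the program has
  finished.\<close>

definition controls :: "com \<Rightarrow> com list set" where
  "controls c = insert [] (reach c [])"

lemma controls_ctl: "L \<in> controls c \<Longrightarrow> fst (ctl L y) \<in> controls c"
  using reach_ctl[of L c "[]" y] by (auto simp: controls_def)

lemma controls_regs: "L \<in> controls c \<Longrightarrow> \<Union> (regs ` set L) \<subseteq> regs c"
  using reach_regs[of L c "[]"] by (auto simp: controls_def)

lemma controls_self: "[c] \<in> controls c"
  using reach_self[of c "[]"] by (auto simp: controls_def)

definition code :: "com \<Rightarrow> com list \<Rightarrow> nat" where
  "code c = (SOME f. bij_betw f (controls c) {..<card (controls c)})"

lemma bij_code: "bij_betw (code c) (controls c) {..<card (controls c)}"
proof -
  have "finite (controls c)" by (simp add: controls_def finite_reach)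
  then have "\<exists>f. bij_betw f (controls c) {..<card (controls c)}"
    using ex_bij_betw_finite_nat[of "controls c"] by (simp add: atLeast0LessThan)
  then show ?thesis unfolding code_def by (rule someI_ex)
qed

definition decode :: "com \<Rightarrow> nat \<Rightarrow> com list" where
  "decode c = inv_into (controls c) (code c)"

lemma decode_code: "K \<in> controls c \<Longrightarrow> decode c (code c K) = K"
  using bij_code[of c] by (simp add: decode_def bij_betw_def)

lemma code_less: "K \<in> controls c \<Longrightarrow> code c K < card (controls c)"
  using bij_code[of c] by (auto simp: bij_betw_def)

lemma decode_in: "i < card (controls c) \<Longrightarrow> decode c i \<in> controls c"
  using bij_code[of c] inv_into_into[of i "code c" "controls c"]
  by (simp add: decode_def bij_betw_def)

lemma card_controls_pos: "0 < card (controls c)"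
  using code_less[OF controls_self[of c]] by simp

text \<open>
  States 2, 3 and 4 copy the input to the work tapes behind the marker 3 and rewind; a control point
  \<open>K\<close> of the program is the state \<open>5 + code c K\<close>.
\<close>

definition delta_of :: "com \<Rightarrow> nat \<Rightarrow> nat \<Rightarrow> nat list \<Rightarrow> nat \<times> (nat \<times> direction) list" where
  "delta_of c k q ss =
    (if q = 2 then (3, (hd ss, Stay) # map (\<lambda>_. (3, Move_Right)) (tl ss))
     else if q = 3 then
       (if hd ss = 0 then (4, (0, Stay) # map (\<lambda>a. (a, Move_Left)) (tl ss))
        else (3, (hd ss, Move_Right) # map (\<lambda>_. (hd ss, Move_Right)) (tl ss)))
     else if q = 4 then
       (if ss ! 1 = 3 then (5 + code c [c], map (\<lambda>a. (a, Stay)) ss)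
        else (4, (hd ss, Stay) # map (\<lambda>a. (a, Move_Left)) (tl ss)))
     else if decode c (q - 5) = [] then
       (if ss ! 1 = 3 then 1 else 0, map (\<lambda>a. (a, Stay)) ss)
     else let (K, d) = ctl (decode c (q - 5)) (\<lambda>i. ss ! Suc i)
       in (5 + code c K, (hd ss, Stay) # map (\<lambda>i. (ss ! Suc i, d i)) [0..<k]))"

definition machine_of :: "com \<Rightarrow> nat \<Rightarrow> machine" where
  "machine_of c k = \<lparr>tapes = Suc k, states = 5 + card (controls c), symbols = 4,
     start = 2, accept = 0, reject = 1, delta = delta_of c k\<rparr>"

lemma machine_of_simps [simp]:
  "tapes (machine_of c k) = Suc k" "states (machine_of c k) = 5 + card (controls c)"
  "symbols (machine_of c k) = 4" "start (machine_of c k) = 2" "accept (machine_of c k) = 0"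
  "reject (machine_of c k) = 1" "delta (machine_of c k) = delta_of c k"
  by (simp_all add: machine_of_def)

lemma turing_machine_machine_of: "turing_machine (machine_of c k)"
proof -
  have "q' < 5 + card (controls c) \<and> length as = Suc k \<and> fst ` set as \<subseteq> {..<4}"
    if q: "q < 5 + card (controls c)" and len: "length ss = Suc k" and sub: "set ss \<subseteq> {..<4}"
      and eq: "delta_of c k q ss = (q', as)" for q ss q' as
  proof -
    obtain a ts where ss: "ss = a # ts" using len by (cases ss) auto
    have "q - 5 < card (controls c)" using q card_controls_pos[of c] by linarith
    then have K: "decode c (q - 5) \<in> controls c" by (rule decode_in)
    note nxt = code_less[OF controls_ctl[OF K]]
    have nth: "i < k \<Longrightarrow> ts ! i < 4" for i
    proof -
      assume "i < k"
      then have "ts ! i \<in> set ts" using len ss by simp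
      then show ?thesis using sub ss by auto
    qed
    show ?thesis
      using eq len sub q nxt nth code_less[OF controls_self[of c]] unfolding ss
      by (auto simp: delta_of_def Let_def case_prod_unfold split: if_splits)
  qed
  then have "\<forall>q ss q' as. q < 5 + card (controls c) \<and> length ss = Suc k \<and> set ss \<subseteq> {..<4} \<and>
      delta_of c k q ss = (q', as) \<longrightarrow>
      q' < 5 + card (controls c) \<and> length as = Suc k \<and> fst ` set as \<subseteq> {..<4}"
    by blast
  then show ?thesis unfolding turing_machine_def machine_of_simps by simp
qed

section \<open>Simulation of programs by the machine\<close>

definition cells :: "bool list \<Rightarrow> int \<Rightarrow> nat" where
  "cells x i = (if i < 0 then 0 else symb x (nat i))"

text \<open>The input tape \<open>t0\<close> is parked once the copies exist. Register
  \<open>i\<close> is the head of tape \<open>Suc i\<close>.\<close>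

definition conf :: "com \<Rightarrow> nat \<Rightarrow> bool list \<Rightarrow> tape \<Rightarrow> com list \<times> (nat \<Rightarrow> nat) \<Rightarrow> nat \<times> tape list" where
  "conf c k x t0 = (\<lambda>(K, s). (5 + code c K, t0 # map (\<lambda>i. (cells x, int (s i))) [0..<k]))"

lemma act_scanned: "act (scanned t, d) t = (fst t, snd t + offset d)"
  by (cases t) auto

lemma cells_nat [simp]: "cells x (int j) = symb x j" "cells x 0 = 3"
  "cells x (int j + 1) = symb x (Suc j)" "cells x (1 + int j) = symb x (Suc j)"
  by (simp_all add: cells_def nat_add_distrib symb_def)

text \<open>Each scanned symbol is written back, so the tape contents stay \<open>cells x\<close>
  and only the heads move.\<close>

lemma conf_step:
  assumes K: "K \<in> controls c" "K \<noteq> []" and k: "regs c \<subseteq> {..<k}"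
  shows "step (machine_of c k) (conf c k x t0 (K, s)) = conf c k x t0 (sstep x (K, s))"
proof -
  let ?ts = "t0 # map (\<lambda>i. (cells x, int (s i))) [0..<k]"
  let ?ss = "scanned t0 # map (\<lambda>i. symb x (s i)) [0..<k]"
  define d where "d = snd (ctl K (symb x \<circ> s))"
  define L where "L = fst (ctl K (symb x \<circ> s))"
  have "ctl K (\<lambda>i. ?ss ! Suc i) = ctl K (symb x \<circ> s)"
  proof (rule ctl_cong)
    fix i
    assume "i \<in> \<Union> (regs ` set K)"
    then have "i < k" using controls_regs[OF K(1)] k by blast
    then show "?ss ! Suc i = (symb x \<circ> s) i" by simp
  qed
  then have ctl: "ctl K (\<lambda>i. ?ss ! Suc i) = (L, d)" by (simp add: d_def L_def)
  have nonneg: "0 \<le> int (s i) + offset (d i)" for i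
    using ctl_Move_Left[of K "symb x \<circ> s" i] by (cases "d i") (auto simp: d_def)
  have pos: "int (nat (int (s i) + offset (d i))) = int (s i) + offset (d i)" for i
    using nonneg[of i] by simp
  have act: "act (symb x (s i), d i) (cells x, int (s i)) = (cells x, int (s i) + offset (d i))" for i
    by (simp add: fun_upd_idem)
  have delta: "delta_of c k (5 + code c K) ?ss
      = (5 + code c L, (scanned t0, Stay) # map (\<lambda>i. (?ss ! Suc i, d i)) [0..<k])"
    using ctl K(2) by (simp add: delta_of_def decode_code[OF K(1)] Let_def)
  have nth: "map (\<lambda>i. (?ss ! Suc i, d i)) [0..<k] = map (\<lambda>i. (symb x (s i), d i)) [0..<k]"
    by simp
  have scanned: "map scanned ?ts = ?ss" by simp
  have "step (machine_of c k) (5 + code c K, ?ts)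
      = (5 + code c L, map2 act ((scanned t0, Stay) # map (\<lambda>i. (symb x (s i), d i)) [0..<k]) ?ts)"
    unfolding step.simps machine_of_simps scanned delta nth by simp
  also have "map2 act ((scanned t0, Stay) # map (\<lambda>i. (symb x (s i), d i)) [0..<k]) ?ts
      = t0 # map (\<lambda>i. (cells x, int (s i) + offset (d i))) [0..<k]"
  proof -
    have "map2 act (map (\<lambda>i. (symb x (s i), d i)) [0..<k]) (map (\<lambda>i. (cells x, int (s i))) [0..<k])
        = map (\<lambda>i. (cells x, int (s i) + offset (d i))) [0..<k]"
      by (rule nth_equalityI) (auto simp: fun_upd_idem)
    then show ?thesis by (cases t0) simp
  qed
  finally show ?thesis by (simp add: conf_def sstep_def pos nonneg L_def[symmetric] d_def[symmetric] del: step.simps)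
qed

text \<open>The empty stack is a fixed point of \<open>sstep\<close>, but the machine leaves it for
  a halting state. The simulation therefore ends when the stack first becomes empty, at some
  \<open>u\<close> that may be smaller than \<open>t\<close>.\<close>

lemma conf_run:
  assumes k: "regs c \<subseteq> {..<k}"
  shows "K \<in> controls c \<Longrightarrow> (sstep x ^^ t) (K, s) = ([], s') \<Longrightarrow>
    \<exists>u\<le>t. (step (machine_of c k) ^^ u) (conf c k x t0 (K, s)) = conf c k x t0 ([], s')"
proof (induction t arbitrary: K s)
  case 0
  then show ?case by auto
next
  case (Suc t)
  show ?case
  proof (cases "K = []")
    case True
    then show ?thesis using Suc.prems(2) by (intro exI[of _ 0]) (simp add: sstep_Nil funpow_sstep_Nil)
  next
    case False
    obtain K' s1 where st: "sstep x (K, s) = (K', s1)" by fastforce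
    then have K': "K' \<in> controls c"
      using controls_ctl[OF Suc.prems(1)] by (auto simp: sstep_def)
    have "(sstep x ^^ t) (K', s1) = ([], s')"
      using Suc.prems(2) st by (simp add: funpow_swap1)
    from Suc.IH[OF K' this] obtain u where u: "u \<le> t"
      "(step (machine_of c k) ^^ u) (conf c k x t0 (K', s1)) = conf c k x t0 ([], s')" by blast
    then have "(step (machine_of c k) ^^ Suc u) (conf c k x t0 (K, s)) = conf c k x t0 ([], s')"
      using conf_step[OF Suc.prems(1) False k] st by (simp only: funpow_Suc_right comp_apply)
    then show ?thesis using u(1) by (intro exI[of _ "Suc u"]) simp
  qed
qed

text \<open>One further step enters state 0 (accept) or 1 (reject), according to whether the head of
  register 0 has left the marker. Both states are fixed points, hence any \<open>j\<close> from 1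
  on.\<close>

lemma conf_halt:
  assumes "regs c \<subseteq> {..<k}" "0 < k" "1 \<le> j"
  shows "fst ((step (machine_of c k) ^^ j) (conf c k x t0 ([], s))) = (if s 0 = 0 then 1 else 0)"
  using \<open>1 \<le> j\<close>
proof (induction j rule: dec_induct)
  case base
  have "(map (\<lambda>i. (cells x, int (s i))) [0..<k]) ! 0 = (cells x, int (s 0))"
    using assms(2) by simp
  then show ?case
    using assms(2) decode_code[of "[]" c]
    by (simp add: conf_def delta_of_def controls_def nth_append cells_def)
next
  case (step j)
  obtain q ts where st: "(Defs.step (machine_of c k) ^^ j) (conf c k x t0 ([], s)) = (q, ts)"
    by fastforce
  show ?case using step.IH st by (auto split: if_splits)
qed

section \<open>Start-up: copying the input and rewinding\<close>

text \<open>The marker occupies cell 0 of the work tapes, so their heads are one cell ahead of the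
  input head. A partial copy looks like a complete copy of \<open>take i x\<close>.\<close>

lemma init_copy:
  assumes "i \<le> length x"
  shows "(step (machine_of c k) ^^ Suc i) (initial (machine_of c k) x)
    = (3, (fst (input_tape x), int i) # replicate k (cells (take i x), int i + 1))"
  using assms
proof (induction i)
  case 0
  have "act (3, Move_Right) blank_tape = (cells [], 1)"
    by (auto simp: blank_tape_def cells_def symb_def fun_eq_iff)
  moreover have "snd (input_tape x) = 0" by (simp add: input_tape_def)
  ultimately show ?case
    by (simp add: initial_def delta_of_def map_replicate_const zip_replicate act_scanned
        del: act.simps)
next
  case (Suc i)
  have upd: "(cells (take i x))(int i + 1 := if x ! i then 2 else 1) = cells (take (Suc i) x)"
    using Suc.prems by (auto simp: cells_def symb_def fun_eq_iff nat_eq_iff min_def nth_append nat_add_distrib)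
  have sc: "fst (input_tape x) (int i) = (if x ! i then 2 else 1)"
    using Suc.prems by (simp add: input_tape_def)
  have "(step (machine_of c k) ^^ Suc (Suc i)) (initial (machine_of c k) x)
      = step (machine_of c k) (3, (fst (input_tape x), int i) # replicate k (cells (take i x), int i + 1))"
    using Suc by simp
  also have "\<dots> = (3, (fst (input_tape x), int (Suc i)) # replicate k (cells (take (Suc i) x), int (Suc i) + 1))"
    using upd sc by (auto simp: delta_of_def map_replicate_const zip_replicate fun_upd_idem)
  finally show ?case .
qed

lemma rewind:
  "(step (machine_of c k) ^^ Suc j) (4, t0 # replicate k (cells x, int j))
    = conf c k x t0 ([c], \<lambda>_. 0)" if "0 < k"
proof (induction j)
  case 0
  show ?case using that
    by (cases t0) (simp add: delta_of_def conf_def map_replicate_const zip_replicate fun_upd_idem)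
next
  case (Suc j)
  have "(step (machine_of c k) ^^ Suc (Suc j)) (4, t0 # replicate k (cells x, int (Suc j)))
      = (step (machine_of c k) ^^ Suc j) (step (machine_of c k) (4, t0 # replicate k (cells x, int (Suc j))))"
    by (simp only: funpow_Suc_right comp_apply)
  also have "step (machine_of c k) (4, t0 # replicate k (cells x, int (Suc j)))
      = (4, t0 # replicate k (cells x, int j))"
    using that by (cases t0) (simp add: delta_of_def zip_replicate fun_upd_idem)
  finally show ?case using Suc by simp
qed

text \<open>The 2n + 3 steps are one for the marker, n for copying, one for turning round at the
  blank, n for going back, and one for loading the first control stack.\<close>

lemma init_conf:
  assumes "0 < k"
  shows "\<exists>t0. (step (machine_of c k) ^^ (2 * length x + 3)) (initial (machine_of c k) x)
    = conf c k x t0 ([c], \<lambda>_. 0)"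
proof -
  let ?M = "machine_of c k" and ?n = "length x"
  let ?t0 = "(fst (input_tape x), int ?n)"
  have "(step ?M ^^ Suc ?n) (initial ?M x) = (3, ?t0 # replicate k (cells x, int ?n + 1))"
    using init_copy[of ?n x c k] by simp
  moreover have "step ?M (3, ?t0 # replicate k (cells x, int ?n + 1)) = (4, ?t0 # replicate k (cells x, int ?n))"
    by (simp add: delta_of_def zip_replicate fun_upd_idem input_tape_def)
  ultimately have "(step ?M ^^ Suc (Suc ?n)) (initial ?M x) = (4, ?t0 # replicate k (cells x, int ?n))"
    by simp
  then have "(step ?M ^^ (Suc ?n + Suc (Suc ?n))) (initial ?M x) = conf c k x ?t0 ([c], \<lambda>_. 0)"
    using rewind[where c = c and k = k and j = ?n and x = x and ?t0.0 = ?t0, OF assms] by (simp only: funpow_add comp_apply)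
  moreover have "Suc ?n + Suc (Suc ?n) = 2 * ?n + 3" by simp
  ultimately show ?thesis by metis
qed

theorem PTIME_I:
  assumes run: "\<And>x. \<exists>s' t. run x c (\<lambda>_. 0) t s' \<and> t \<le> poly p (length x) \<and> (s' 0 \<noteq> 0 \<longleftrightarrow> x \<in> L)"
  shows "L \<in> PTIME"
proof -
  obtain k where k: "regs c \<subseteq> {..<k}" "0 < k"
  proof
    \<comment> \<open>Inserting 0 guarantees \<open>k > 0\<close>: register 0 carries the answer and
      needs a tape even if the program does not mention it.\<close>
    show "regs c \<subseteq> {..<Suc (Max (insert 0 (regs c)))}"
      using finite_regs[of c] by (auto simp: less_Suc_eq_le)
  qed simp
  let ?M = "machine_of c k"
  \<comment> \<open>Start-up takes 2n + 3 steps and the final decision at least one.\<close>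
  let ?p = "p + [:4, 2:]"
  have "fst ((step ?M ^^ poly ?p (length x)) (initial ?M x)) = (if x \<in> L then accept ?M else reject ?M)"
    for x
  proof -
    obtain s' t where t: "run x c (\<lambda>_. 0) t s'" "t \<le> poly p (length x)" "s' 0 \<noteq> 0 \<longleftrightarrow> x \<in> L"
      using run by blast
    obtain t0 where t0: "(step ?M ^^ (2 * length x + 3)) (initial ?M x) = conf c k x t0 ([c], \<lambda>_. 0)"
      using init_conf[OF k(2)] by blast
    have "(sstep x ^^ t) ([c], \<lambda>_. 0) = ([], s')" using t(1) by (simp add: run_def)
    then obtain u where u: "u \<le> t" "(step ?M ^^ u) (conf c k x t0 ([c], \<lambda>_. 0)) = conf c k x t0 ([], s')"
      using conf_run[OF k(1) controls_self] by blast
    \<comment> \<open>\<open>decides_within\<close> fixes the exact number of steps; the surplus is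
      spent idling in the halting state.\<close>
    define j where "j = poly p (length x) - u + 1"
    have "poly ?p (length x) = j + (u + (2 * length x + 3))"
      using u(1) t(2) by (simp add: j_def)
    then have "(step ?M ^^ poly ?p (length x)) (initial ?M x) = (step ?M ^^ j) (conf c k x t0 ([], s'))"
      using u(2) t0 by (simp only: funpow_add comp_apply)
    then show ?thesis using conf_halt[OF k, of j x t0 s'] t(3) by (auto simp: j_def)
  qed
  then have "decides_within ?M L (poly ?p)" by (simp add: decides_within_def)
  then show ?thesis using turing_machine_machine_of by (auto simp: PTIME_def)
qed

section \<open>Polynomial-time computable functions of the head positions\<close>

lemma ctl_Move_Right: "snd (ctl K y) i = Move_Right \<Longrightarrow> y i \<noteq> 0"
  by (induction K y rule: ctl.induct) (auto split: if_splits)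

definition bounded :: "bool list \<Rightarrow> (nat \<Rightarrow> nat) \<Rightarrow> bool" where
  "bounded x s \<longleftrightarrow> (\<forall>i. s i \<le> Suc (length x))"

lemma bounded_upd [simp]: "bounded x s \<Longrightarrow> v \<le> Suc (length x) \<Longrightarrow> bounded x (s(i := v))"
  by (auto simp: bounded_def)

lemma boundedD: "bounded x s \<Longrightarrow> s i \<le> Suc (length x)"
  by (auto simp: bounded_def)

lemma bounded_sstep:
  assumes "bounded x s"
  shows "bounded x (snd (sstep x (K, s)))"
  unfolding bounded_def
proof
  fix i
  show "snd (sstep x (K, s)) i \<le> Suc (length x)"
    using ctl_Move_Right[of K "symb x \<circ> s" i] boundedD[OF assms, of i]
    by (cases "snd (ctl K (symb x \<circ> s)) i") (auto simp: sstep_def)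
qed

lemma bounded_funpow_sstep: "bounded x s \<Longrightarrow> bounded x (snd ((sstep x ^^ t) (K, s)))"
proof (induction t)
  case (Suc t)
  then show ?case using bounded_sstep[of x "snd ((sstep x ^^ t) (K, s))"] by (metis comp_apply funpow.simps(2) prod.collapse)
qed simp

text \<open>Only an upper bound on the time is recorded, so that bounds can be rounded up to
  polynomials.\<close>

definition exec :: "bool list \<Rightarrow> com \<Rightarrow> (nat \<Rightarrow> nat) \<Rightarrow> nat \<Rightarrow> (nat \<Rightarrow> nat) \<Rightarrow> bool" where
  "exec x c s B s' \<longleftrightarrow> (\<exists>t\<le>B. run x c s t s')"

lemma exec_bounded: "exec x c s B s' \<Longrightarrow> bounded x s \<Longrightarrow> bounded x s'"
  unfolding exec_def run_def using bounded_funpow_sstep[of x s _ "[c]"] by (metis snd_conv)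

lemma exec_mono: "exec x c s B s' \<Longrightarrow> B \<le> C \<Longrightarrow> exec x c s C s'"
  using le_trans by (fastforce simp: exec_def)

lemma exec_Skip: "exec x Skip s (Suc 0) s"
  using run_Skip by (auto simp: exec_def)

lemma exec_Inc: "exec x (Inc v) s 1 (s(v := if s v \<le> length x then Suc (s v) else s v))"
  using run_Inc unfolding exec_def by blast

lemma exec_Inc': "s v \<le> length x \<Longrightarrow> s' = s(v := Suc (s v)) \<Longrightarrow> exec x (Inc v) s 1 s'"
  using exec_Inc[of x v s] by simp

lemma exec_Dec: "exec x (Dec v) s 1 (s(v := s v - 1))"
  using run_Dec unfolding exec_def by blast

lemma exec_Seq: "exec x a s B s1 \<Longrightarrow> exec x b s1 C s2 \<Longrightarrow> exec x (Seq a b) s (Suc (B + C)) s2"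
  using run_Seq[of x a s _ s1 b _ s2] unfolding exec_def by (meson Suc_le_mono add_mono)

lemma exec_Branch:
  "exec x (if S (symb x (s v)) then a else b) s B s' \<Longrightarrow> exec x (Branch v S a b) s (Suc B) s'"
  using run_Branch[of x S s v a b] unfolding exec_def by (meson Suc_le_mono)

lemma exec_Loop_exit: "\<not> S (symb x (s v)) \<Longrightarrow> exec x (Loop v S a) s 1 s"
  using run_Loop_exit unfolding exec_def by blast

lemma exec_Loop_step:
  "S (symb x (s v)) \<Longrightarrow> exec x a s B s1 \<Longrightarrow> exec x (Loop v S a) s1 C s2 \<Longrightarrow>
    exec x (Loop v S a) s (Suc (B + C)) s2"
  using run_Loop_step[of S x s v a _ s1 _ s2] unfolding exec_def by (meson Suc_le_mono add_mono)

abbreviation Countdown :: "nat \<Rightarrow> com \<Rightarrow> com" where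
  "Countdown j c \<equiv> Loop j (\<lambda>a. a \<noteq> 3) (Seq (Dec j) c)"

text \<open>The invariant is indexed by the rounds left, and the body sees the counter already
  decremented. A round costs \<open>B\<close> plus the loop test, the sequencing and the decrement;
  the last 1 is the failing test.\<close>

lemma exec_Countdown:
  assumes body: "\<And>k s. I (Suc k) s \<Longrightarrow> s j = Suc k \<Longrightarrow>
    \<exists>s'. exec x c (s(j := k)) B s' \<and> s' j = k \<and> I k s'"
  shows "I N s \<Longrightarrow> s j = N \<Longrightarrow> \<exists>s'. exec x (Countdown j c) s (N * (B + 3) + 1) s' \<and> s' j = 0 \<and> I 0 s'"
proof (induction N arbitrary: s)
  case 0
  then show ?case using exec_Loop_exit[of "\<lambda>a. a \<noteq> 3" x s j] by auto
next
  case (Suc N)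
  obtain s1 where s1: "exec x c (s(j := N)) B s1" "s1 j = N" "I N s1" using body Suc.prems by blast
  obtain s2 where s2: "exec x (Countdown j c) s1 (N * (B + 3) + 1) s2" "s2 j = 0" "I 0 s2"
    using Suc.IH s1 by blast
  have "exec x (Dec j) s 1 (s(j := N))" using exec_Dec[of x j s] Suc.prems by simp
  from exec_Loop_step[OF _ exec_Seq[OF this s1(1)] s2(1)]
  have "exec x (Countdown j c) s (Suc (Suc (1 + B) + (N * (B + 3) + 1))) s2"
    using Suc.prems by simp
  moreover have "Suc (Suc (1 + B) + (N * (B + 3) + 1)) = Suc N * (B + 3) + 1" by simp
  ultimately show ?case using s2 by (metis (no_types))
qed

definition Clear :: "nat \<Rightarrow> com" where
  "Clear j = Countdown j Skip"

lemma exec_Clear: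
  assumes "bounded x s"
  shows "exec x (Clear j) s (4 * length x + 5) (s(j := 0))"
proof -
  have "\<exists>s'. exec x (Countdown j Skip) s (s j * (1 + 3) + 1) s' \<and> s' j = 0 \<and> s' = s(j := 0)"
    by (rule exec_Countdown[where I = "\<lambda>k s'. s' = s(j := k)"]) (auto intro: exec_Skip)
  then show ?thesis using boundedD[OF assms, of j] unfolding Clear_def by (auto elim!: exec_mono)
qed

text \<open>A position can be read out only by counting it down. So \<open>a\<close> is drained into
  \<open>b\<close> and \<open>d\<close> at once and then restored from the scratch register
  \<open>d\<close>.\<close>

definition Copy :: "nat \<Rightarrow> nat \<Rightarrow> nat \<Rightarrow> com" where
  "Copy a b d = Seq (Clear b) (Seq (Clear d)
     (Seq (Countdown a (Seq (Inc b) (Inc d))) (Countdown d (Inc a))))"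

lemma exec_Copy:
  assumes bd: "bounded x s" and ne: "a \<noteq> b" "a \<noteq> d" "b \<noteq> d"
  shows "exec x (Copy a b d) s (20 * length x + 30) (s(b := s a, d := 0))"
proof -
  let ?n = "length x" and ?N = "s a"
  note N = boundedD[OF bd, of a]
  let ?s2 = "s(b := 0, d := 0)" and ?s3 = "s(a := 0, b := ?N, d := ?N)"
  have c1: "exec x (Clear b) s (4 * ?n + 5) (s(b := 0))" using exec_Clear[OF bd] .
  have c2: "exec x (Clear d) (s(b := 0)) (4 * ?n + 5) ?s2"
    using exec_Clear[of x "s(b := 0)" d] bd by simp
  have "\<exists>s'. exec x (Countdown a (Seq (Inc b) (Inc d))) ?s2 (?N * (3 + 3) + 1) s' \<and> s' a = 0 \<and>
      s' = s(a := 0, b := ?N - 0, d := ?N - 0) \<and> 0 \<le> ?N"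
  proof (rule exec_Countdown[where I = "\<lambda>k s'. s' = s(a := k, b := ?N - k, d := ?N - k) \<and> k \<le> ?N"])
    fix k s'
    assume I: "s' = s(a := Suc k, b := ?N - Suc k, d := ?N - Suc k) \<and> Suc k \<le> ?N"
    let ?u = "s'(a := k)"
    have 1: "exec x (Inc b) ?u 1 (?u(b := ?N - k))"
      using I N ne by (intro exec_Inc') (auto simp: Suc_diff_Suc)
    have 2: "exec x (Inc d) (?u(b := ?N - k)) 1 (?u(b := ?N - k, d := ?N - k))"
      using I N ne by (intro exec_Inc') (auto simp: Suc_diff_Suc)
    have 3: "?u(b := ?N - k, d := ?N - k) = s(a := k, b := ?N - k, d := ?N - k)"
      using I ne by (auto simp: fun_eq_iff)
    show "\<exists>s''. exec x (Seq (Inc b) (Inc d)) ?u 3 s'' \<and> s'' a = k \<and>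
        s'' = s(a := k, b := ?N - k, d := ?N - k) \<and> k \<le> ?N"
      using exec_Seq[OF 1 2] I ne unfolding 3 by (auto simp: numeral_3_eq_3)
  qed (use ne in \<open>auto simp: fun_eq_iff\<close>)
  then have c3: "exec x (Countdown a (Seq (Inc b) (Inc d))) ?s2 (6 * ?n + 7) ?s3"
    using N by (auto elim!: exec_mono)
  have "\<exists>s'. exec x (Countdown d (Inc a)) ?s3 (?N * (1 + 3) + 1) s' \<and> s' d = 0 \<and>
      s' = s(a := ?N - 0, b := ?N, d := 0) \<and> 0 \<le> ?N"
  proof (rule exec_Countdown[where I = "\<lambda>k s'. s' = s(a := ?N - k, b := ?N, d := k) \<and> k \<le> ?N"])
    fix k s'
    assume I: "s' = s(a := ?N - Suc k, b := ?N, d := Suc k) \<and> Suc k \<le> ?N"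
    have "(s'(d := k))(a := ?N - k) = s(a := ?N - k, b := ?N, d := k)"
      using I ne by (auto simp: fun_eq_iff)
    then show "\<exists>s''. exec x (Inc a) (s'(d := k)) 1 s'' \<and> s'' d = k \<and>
        s'' = s(a := ?N - k, b := ?N, d := k) \<and> k \<le> ?N"
      using I N ne by (auto simp: Suc_diff_Suc intro!: exec_Inc'[simplified])
  qed (use ne in \<open>auto simp: fun_eq_iff\<close>)
  then have c4: "exec x (Countdown d (Inc a)) ?s3 (4 * ?n + 5) (s(a := ?N, b := ?N, d := 0))"
    using N by (auto elim!: exec_mono)
  have "s(a := ?N, b := ?N, d := 0) = s(b := ?N, d := 0)" by (auto simp: fun_eq_iff)
  with exec_Seq[OF c1 exec_Seq[OF c2 exec_Seq[OF c3 c4]]] show ?thesis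
    unfolding Copy_def by (auto elim!: exec_mono)
qed

section \<open>Computable functions and their closure properties\<close>

definition prog :: "nat \<Rightarrow> (bool list \<Rightarrow> (nat \<Rightarrow> nat) \<Rightarrow> nat) \<Rightarrow> com \<Rightarrow> nat poly \<Rightarrow> bool" where
  "prog m E c p \<longleftrightarrow> (\<forall>x s. bounded x s \<longrightarrow>
    (\<exists>s'. exec x c s (poly p (length x)) s' \<and> (\<forall>i<m. s' i = s i) \<and> s' m = E x s))"

text \<open>Subcomputations overwrite the registers from \<open>m\<close> on, so an expression
  evaluated after one of them must not depend on these.\<close>

definition indep :: "nat \<Rightarrow> (bool list \<Rightarrow> (nat \<Rightarrow> nat) \<Rightarrow> 'a) \<Rightarrow> bool" where
  "indep m E \<longleftrightarrow> (\<forall>x s s'. (\<forall>i<m. s i = s' i) \<longrightarrow> E x s = E x s')"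

text \<open>
  The program for \<open>E\<close> leaves its value in register \<open>k\<close> and may use all later registers as scratch
  space; allowing every \<open>k \<ge> m\<close> makes computations nest.
\<close>

definition computable :: "nat \<Rightarrow> (bool list \<Rightarrow> (nat \<Rightarrow> nat) \<Rightarrow> nat) \<Rightarrow> bool" where
  "computable m E \<longleftrightarrow> indep m E \<and> (\<forall>k\<ge>m. \<exists>c p. prog k E c p)"

abbreviation decidable :: "nat \<Rightarrow> (bool list \<Rightarrow> (nat \<Rightarrow> nat) \<Rightarrow> bool) \<Rightarrow> bool" where
  "decidable m P \<equiv> computable m (\<lambda>x s. of_bool (P x s))"

lemma progE:
  assumes "prog m E c p" "bounded x s"
  obtains s' where "exec x c s (poly p (length x)) s'" "\<And>i. i < m \<Longrightarrow> s' i = s i" "s' m = E x s"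
    "bounded x s'"
  using assms exec_bounded unfolding prog_def by blast

lemma computable_weaken:
  assumes "computable m E" "m \<le> k"
  shows "computable k E"
  using assms by (force simp: computable_def indep_def)

lemma computable_indep: "computable m E \<Longrightarrow> (\<And>i. i < m \<Longrightarrow> s i = s' i) \<Longrightarrow> E x s = E x s'"
  by (auto simp: computable_def indep_def)

lemma computable_prog:
  assumes "computable m E" "m \<le> k"
  obtains c p where "prog k E c p"
  using assms by (auto simp: computable_def)

lemma computable_var:
  assumes "a < m"
  shows "computable m (\<lambda>x s. s a)"
proof -
  have "prog k (\<lambda>x s. s a) (Copy a k (Suc k)) [:30, 20:]" if "m \<le> k" for k
    unfolding prog_def
  proof (intro allI impI)
    fix x s
    assume "bounded x s"
    from exec_Copy[OF this, of a k "Suc k"]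
    show "\<exists>s'. exec x (Copy a k (Suc k)) s (poly [:30, 20:] (length x)) s' \<and> (\<forall>i<k. s' i = s i) \<and> s' k = s a"
      using assms that by (intro exI[of _ "s(k := s a, Suc k := 0)"]) (auto elim!: exec_mono)
  qed
  then show ?thesis using assms by (auto simp: computable_def indep_def)
qed

lemma computable_0: "computable m (\<lambda>x s. 0)"
proof -
  have "prog k (\<lambda>x s. 0) (Clear k) [:5, 4:]" for k
    unfolding prog_def
  proof (intro allI impI)
    fix x s
    assume "bounded x s"
    from exec_Clear[OF this, of k]
    show "\<exists>s'. exec x (Clear k) s (poly [:5, 4:] (length x)) s' \<and> (\<forall>i<k. s' i = s i) \<and> s' k = 0"
      by (intro exI[of _ "s(k := 0)"]) (auto elim!: exec_mono)
  qed
  then show ?thesis by (auto simp: computable_def indep_def)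
qed

text \<open>A head pushed right until it scans the blank stands at \<open>length x + 1\<close>. This
  is where the loop bounds \<open>length x\<close> come from.\<close>

lemma computable_full: "computable m (\<lambda>x s. Suc (length x))"
proof -
  let ?L = "\<lambda>k. Loop k (\<lambda>a. a \<noteq> 0) (Inc k)"
  have L: "exec x (?L k) s (j * 2 + 1) (s(k := Suc (length x)))"
    if "s k + j = Suc (length x)" for x s k j
    using that
  proof (induction j arbitrary: s)
    case 0
    then show ?case using exec_Loop_exit[of "\<lambda>a. a \<noteq> 0" x s k] by (simp add: fun_upd_idem)
  next
    case (Suc j)
    have "exec x (Inc k) s 1 (s(k := Suc (s k)))" using exec_Inc[of x k s] Suc.prems by simp
    moreover have "exec x (?L k) (s(k := Suc (s k))) (j * 2 + 1) (s(k := Suc (length x)))"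
      using Suc.IH[of "s(k := Suc (s k))"] Suc.prems by (simp only: fun_upd_same fun_upd_upd)
    ultimately have "exec x (?L k) s (Suc (1 + (j * 2 + 1))) (s(k := Suc (length x)))"
      using Suc.prems by (intro exec_Loop_step[of "\<lambda>a. a \<noteq> 0"]) (simp, assumption+)
    then show ?case by (elim exec_mono) simp
  qed
  have "prog k (\<lambda>x s. Suc (length x)) (Seq (Clear k) (?L k)) [:9, 6:]" for k
    unfolding prog_def
  proof (intro allI impI)
    fix x s
    assume "bounded x s"
    from exec_Seq[OF exec_Clear[OF this, of k] L[of "s(k := 0)" k "Suc (length x)" x]]
    show "\<exists>s'. exec x (Seq (Clear k) (?L k)) s (poly [:9, 6:] (length x)) s' \<and> (\<forall>i<k. s' i = s i) \<and>
        s' k = Suc (length x)"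
      by (intro exI[of _ "s(k := Suc (length x))"]) (auto elim!: exec_mono)
  qed
  then show ?thesis by (auto simp: computable_def indep_def)
qed

text \<open>The saturating successor that \<open>Inc\<close> really computes: a head on the blank
  stays there.\<close>

definition csuc :: "bool list \<Rightarrow> nat \<Rightarrow> nat" where
  "csuc x v = (if v \<le> length x then Suc v else v)"

lemma computable_post:
  assumes E: "computable m E" 
    and c: "\<And>x s k. bounded x s \<Longrightarrow> exec x (c k) s (poly p (length x)) (s(k := f x (s k)))"
  shows "computable m (\<lambda>x s. f x (E x s))"
proof -
  have "\<exists>c p. prog k (\<lambda>x s. f x (E x s)) c p" if "m \<le> k" for k
  proof -
    obtain c1 p1 where c1: "prog k E c1 p1" using computable_prog[OF E \<open>m \<le> k\<close>] .
    have "prog k (\<lambda>x s. f x (E x s)) (Seq c1 (c k)) (p1 + p + 1)"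
      unfolding prog_def
    proof (intro allI impI)
      fix x s
      assume "bounded x s"
      from c1 this obtain s1 where s1: "exec x c1 s (poly p1 (length x)) s1"
        "\<And>i. i < k \<Longrightarrow> s1 i = s i" "s1 k = E x s" "bounded x s1" by (rule progE) blast
      show "\<exists>s'. exec x (Seq c1 (c k)) s (poly (p1 + p + 1) (length x)) s' \<and> (\<forall>i<k. s' i = s i) \<and>
          s' k = f x (E x s)"
        using exec_Seq[OF s1(1) c[OF s1(4), of k]] s1(2,3)
        by (intro exI[of _ "s1(k := f x (E x s))"]) (auto elim!: exec_mono)
    qed
    then show ?thesis by blast
  qed
  moreover have "indep m (\<lambda>x s. f x (E x s))"
    using E by (auto simp: computable_def indep_def) metis
  ultimately show ?thesis by (simp add: computable_def)
qed

lemma computable_csuc: "computable m E \<Longrightarrow> computable m (\<lambda>x s. csuc x (E x s))"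
  by (erule computable_post[where c = Inc and p = 1 and f = csuc])
    (simp only: csuc_def poly_1 exec_Inc)

lemma computable_pred: "computable m E \<Longrightarrow> computable m (\<lambda>x s. E x s - 1)"
  by (erule computable_post[where c = Dec and p = 1 and f = "\<lambda>x v. v - 1"])
    (simp only: poly_1 exec_Dec)

lemma decidable_symb:
  assumes "computable m E"
  shows "decidable m (\<lambda>x s. S (symb x (E x s)))"
proof (rule computable_post[OF assms])
  let ?c = "\<lambda>k. Branch k S (Seq (Clear k) (Inc k)) (Clear k)"
  show "exec x (?c k) s (poly [:8, 4:] (length x)) (s(k := of_bool (S (symb x (s k)))))"
    if b: "bounded x s" for x s k
  proof -
    have "exec x (Inc k) (s(k := 0)) 1 (s(k := 1))" using exec_Inc[of x k "s(k := 0)"] by simp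
    from exec_Seq[OF exec_Clear[OF b] this] exec_Clear[OF b, of k]
    have "exec x (if S (symb x (s k)) then Seq (Clear k) (Inc k) else Clear k) s (4 * length x + 7)
        (s(k := of_bool (S (symb x (s k)))))"
      by (auto elim!: exec_mono)
    from exec_Branch[where S = S, OF this] show ?thesis by (elim exec_mono) simp
  qed
qed

text \<open>The value of \<open>E\<close> is parked in register \<open>k\<close>, \<open>F\<close>
  is evaluated above it, and the result is copied down to \<open>k\<close>. The premise on
  \<open>F\<close> is required for all \<open>k\<close> from \<open>m\<close> on, because the depth
  of nesting is not known in advance.\<close>

lemma computable_let:
  assumes E: "computable m E" and F: "\<And>k. m \<le> k \<Longrightarrow> computable (Suc k) (\<lambda>x s. F x s (s k))"
    and ind: "\<And>x s s' v. (\<And>i. i < m \<Longrightarrow> s i = s' i) \<Longrightarrow> F x s v = F x s' v"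
  shows "computable m (\<lambda>x s. F x s (E x s))"
proof -
  have "\<exists>c p. prog k (\<lambda>x s. F x s (E x s)) c p" if "m \<le> k" for k
  proof -
    obtain c1 p1 where c1: "prog k E c1 p1" using computable_prog[OF E \<open>m \<le> k\<close>] .
    obtain c2 p2 where c2: "prog (Suc k) (\<lambda>x s. F x s (s k)) c2 p2"
      using computable_prog[OF F[OF \<open>m \<le> k\<close>] order_refl] .
    let ?c = "Seq c1 (Seq c2 (Copy (Suc k) k (Suc (Suc k))))"
    have "prog k (\<lambda>x s. F x s (E x s)) ?c (p1 + p2 + [:32, 20:])"
      unfolding prog_def
    proof (intro allI impI)
      fix x s
      assume "bounded x s"
      from c1 this obtain s1 where s1: "exec x c1 s (poly p1 (length x)) s1"
        "\<And>i. i < k \<Longrightarrow> s1 i = s i" "s1 k = E x s" "bounded x s1" by (rule progE) blast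
      from c2 s1(4) obtain s2 where s2: "exec x c2 s1 (poly p2 (length x)) s2"
        "\<And>i. i < Suc k \<Longrightarrow> s2 i = s1 i" "s2 (Suc k) = F x s1 (s1 k)" "bounded x s2"
        by (rule progE) blast
      have "F x s1 (s1 k) = F x s (E x s)" using ind[of s1 s x] s1(2,3) that by simp
      then show "\<exists>s'. exec x ?c s (poly (p1 + p2 + [:32, 20:]) (length x)) s' \<and> (\<forall>i<k. s' i = s i) \<and>
          s' k = F x s (E x s)"
        using exec_Seq[OF s1(1) exec_Seq[OF s2(1) exec_Copy[OF s2(4), of "Suc k" k "Suc (Suc k)"]]] s1(2) s2(2,3)
        by (intro exI[of _ "s2(k := F x s (E x s), Suc (Suc k) := 0)"]) (auto elim!: exec_mono)
    qed
    then show ?thesis by blast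
  qed
  moreover have "indep m (\<lambda>x s. F x s (E x s))"
    unfolding indep_def using ind computable_indep[OF E] by metis
  ultimately show ?thesis by (simp add: computable_def)
qed

lemma computable_if:
  assumes P: "decidable m P" and E: "computable m E" and F: "computable m F"
  shows "computable m (\<lambda>x s. if P x s then E x s else F x s)"
proof -
  have "\<exists>c p. prog k (\<lambda>x s. if P x s then E x s else F x s) c p" if "m \<le> k" for k
  proof -
    obtain c1 p1 where c1: "prog k (\<lambda>x s. of_bool (P x s)) c1 p1" using computable_prog[OF P \<open>m \<le> k\<close>] .
    obtain c2 p2 where c2: "prog k E c2 p2" using computable_prog[OF E \<open>m \<le> k\<close>] .
    obtain c3 p3 where c3: "prog k F c3 p3" using computable_prog[OF F \<open>m \<le> k\<close>] .
    let ?c = "Seq c1 (Branch k (\<lambda>a. a \<noteq> 3) c2 c3)"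
    have "prog k (\<lambda>x s. if P x s then E x s else F x s) ?c (p1 + p2 + p3 + 2)"
      unfolding prog_def
    proof (intro allI impI)
      fix x s
      assume "bounded x s"
      from c1 this obtain s1 where s1: "exec x c1 s (poly p1 (length x)) s1"
        "\<And>i. i < k \<Longrightarrow> s1 i = s i" "s1 k = of_bool (P x s)" "bounded x s1" by (rule progE) blast
      from c2 s1(4) obtain s2 where s2: "exec x c2 s1 (poly p2 (length x)) s2"
        "\<And>i. i < k \<Longrightarrow> s2 i = s1 i" "s2 k = E x s1" by (rule progE) blast
      from c3 s1(4) obtain s3 where s3: "exec x c3 s1 (poly p3 (length x)) s3"
        "\<And>i. i < k \<Longrightarrow> s3 i = s1 i" "s3 k = F x s1" by (rule progE) blast
      define s' where "s' = (if P x s then s2 else s3)"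
      have "exec x (if symb x (s1 k) \<noteq> 3 then c2 else c3) s1 (poly p2 (length x) + poly p3 (length x)) s'"
        using s2(1) s3(1) s1(3) by (auto simp: s'_def elim!: exec_mono)
      from exec_Seq[OF s1(1) exec_Branch[where S = "\<lambda>a. a \<noteq> 3", OF this]]
      have "exec x ?c s (poly (p1 + p2 + p3 + 2) (length x)) s'" by (auto elim!: exec_mono)
      moreover have "s' k = (if P x s then E x s else F x s)"
        using s2(3) s3(3) computable_indep[OF E, of s1 s x] computable_indep[OF F, of s1 s x] s1(2) that
        by (auto simp: s'_def)
      moreover have "\<forall>i<k. s' i = s i" using s1(2) s2(2) s3(2) by (auto simp: s'_def)
      ultimately show "\<exists>s'. exec x ?c s (poly (p1 + p2 + p3 + 2) (length x)) s' \<and> (\<forall>i<k. s' i = s i) \<and>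
          s' k = (if P x s then E x s else F x s)" by blast
    qed
    then show ?thesis by blast
  qed
  moreover have "indep m (\<lambda>x s. if P x s then E x s else F x s)"
  proof -
    have "P x s = P x s'" if "\<forall>i<m. s i = s' i" for x s s'
      using computable_indep[OF P, of s s' x] that by (auto simp: of_bool_def split: if_splits)
    then show ?thesis
      unfolding indep_def using computable_indep[OF E] computable_indep[OF F] by metis
  qed
  ultimately show ?thesis by (simp add: computable_def)
qed

text \<open>The index decreases from \<open>k - 1\<close> to 0, following the counter of
  \<open>Countdown\<close>. Loops for which the order matters must reverse it explicitly.\<close>

primrec iter :: "(nat \<Rightarrow> 'a \<Rightarrow> 'a) \<Rightarrow> nat \<Rightarrow> 'a \<Rightarrow> 'a" where
  "iter f 0 a = a"
| "iter f (Suc k) a = iter f k (f k a)"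

text \<open>Register \<open>k\<close> is the accumulator and \<open>Suc k\<close> the counter; the
  body computes into the register after them and the result is copied back to
  \<open>k\<close>.\<close>

lemma computable_iter:
  assumes N: "computable m N" and A: "computable m A"
    and F: "\<And>k. m \<le> k \<Longrightarrow> computable (Suc (Suc k)) (\<lambda>x s. F x s (s (Suc k)) (s k))"
    and ind: "\<And>x s s' u v. (\<And>i. i < m \<Longrightarrow> s i = s' i) \<Longrightarrow> F x s u v = F x s' u v"
  shows "computable m (\<lambda>x s. iter (F x s) (N x s) (A x s))"
proof -
  have "\<exists>c p. prog k (\<lambda>x s. iter (F x s) (N x s) (A x s)) c p" if "m \<le> k" for k
  proof -
    obtain c1 p1 where c1: "prog k A c1 p1" using computable_prog[OF A \<open>m \<le> k\<close>] .
    obtain c2 p2 where c2: "prog (Suc k) N c2 p2" using computable_prog[OF N le_SucI[OF \<open>m \<le> k\<close>]] .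
    obtain c3 p3 where c3: "prog (Suc (Suc k)) (\<lambda>x s. F x s (s (Suc k)) (s k)) c3 p3"
      using computable_prog[OF F[OF \<open>m \<le> k\<close>] order_refl] .
    let ?b = "Seq c3 (Copy (Suc (Suc k)) k (Suc (Suc (Suc k))))"
    let ?c = "Seq c1 (Seq c2 (Countdown (Suc k) ?b))"
    let ?p3 = "p3 + [:31, 20:]"
    let ?p = "p1 + p2 + [:1, 1:] * (?p3 + 3) + 3"
    have "prog k (\<lambda>x s. iter (F x s) (N x s) (A x s)) ?c ?p"
      unfolding prog_def
    proof (intro allI impI)
      fix x s
      assume "bounded x s"
      from c1 this obtain s1 where s1: "exec x c1 s (poly p1 (length x)) s1"
        "\<And>i. i < k \<Longrightarrow> s1 i = s i" "s1 k = A x s" "bounded x s1" by (rule progE) blast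
      from c2 s1(4) obtain s2 where s2: "exec x c2 s1 (poly p2 (length x)) s2"
        "\<And>i. i < Suc k \<Longrightarrow> s2 i = s1 i" "s2 (Suc k) = N x s1" "bounded x s2"
        by (rule progE) blast
      have N1: "N x s1 = N x s" using computable_indep[OF N, of s1 s x] s1(2) that by simp
      let ?r = "iter (F x s) (N x s) (A x s)"
      \<comment> \<open>Applying the remaining \<open>j\<close> rounds to the current accumulator
        already gives the final result.\<close>
      define I where "I j s' \<longleftrightarrow> bounded x s' \<and> (\<forall>i<k. s' i = s i) \<and> iter (F x s) j (s' k) = ?r" for j s'
      have "\<exists>s'. exec x (Countdown (Suc k) ?b) s2 (N x s * (poly ?p3 (length x) + 3) + 1) s' \<and>
          s' (Suc k) = 0 \<and> I 0 s'"
      proof (rule exec_Countdown[where I = I])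
        show "I (N x s) s2" using s1 s2 by (simp add: I_def)
        show "s2 (Suc k) = N x s" using s2 N1 by simp
        fix j s'
        assume I: "I (Suc j) s'" and sj: "s' (Suc k) = Suc j"
        let ?s = "s'(Suc k := j)"
        have b: "bounded x ?s" using I boundedD[of x s' "Suc k"] sj by (simp add: I_def)
        from c3 b obtain s3 where s3: "exec x c3 ?s (poly p3 (length x)) s3"
          "\<And>i. i < Suc (Suc k) \<Longrightarrow> s3 i = ?s i" "s3 (Suc (Suc k)) = F x ?s j (s' k)" "bounded x s3"
          by (rule progE) auto
        let ?t = "s3(k := s3 (Suc (Suc k)), Suc (Suc (Suc k)) := 0)"
        have e: "exec x ?b ?s (poly ?p3 (length x)) ?t"
          using exec_Seq[OF s3(1) exec_Copy[OF s3(4), of "Suc (Suc k)" k "Suc (Suc (Suc k))"]]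
          by (auto elim!: exec_mono)
        have "F x ?s j (s' k) = F x s j (s' k)" using ind[of ?s s x] I that by (simp add: I_def)
        then have "I j ?t" using I s3 exec_bounded[OF e b] by (simp add: I_def)
        moreover have "?t (Suc k) = j" using s3(2) by simp
        ultimately show "\<exists>s''. exec x ?b ?s (poly ?p3 (length x)) s'' \<and> s'' (Suc k) = j \<and> I j s''"
          using e by blast
      qed
      then obtain s' where s': "exec x (Countdown (Suc k) ?b) s2 (N x s * (poly ?p3 (length x) + 3) + 1) s'"
        "I 0 s'" by blast
      \<comment> \<open>The number of rounds was held in a register, so the register range bounds it
        by n + 1 whatever \<open>N\<close> is.\<close>
      have "N x s \<le> length x + 1" using boundedD[OF s2(4), of "Suc k"] s2(3) N1 by simp
      then have "N x s * (poly ?p3 (length x) + 3) \<le> (length x + 1) * (poly ?p3 (length x) + 3)"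
        by (rule mult_le_mono1)
      then have "exec x ?c s (poly ?p (length x)) s'"
        using exec_Seq[OF s1(1) exec_Seq[OF s2(1) s'(1)]] by (elim exec_mono) (simp add: algebra_simps)
      then show "\<exists>s'. exec x ?c s (poly ?p (length x)) s' \<and> (\<forall>i<k. s' i = s i) \<and> s' k = ?r"
        using s'(2) unfolding I_def by auto
    qed
    then show ?thesis by blast
  qed
  moreover have "indep m (\<lambda>x s. iter (F x s) (N x s) (A x s))"
    unfolding indep_def
  proof (intro allI impI)
    fix x and s s' :: "nat \<Rightarrow> nat"
    assume "\<forall>i<m. s i = s' i"
    then have "F x s = F x s'" "N x s = N x s'" "A x s = A x s'"
      using ind[of s s' x] computable_indep[OF N, of s s' x] computable_indep[OF A, of s s' x]
      by (auto simp: fun_eq_iff)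
    then show "iter (F x s) (N x s) (A x s) = iter (F x s') (N x s') (A x s')" by simp
  qed
  ultimately show ?thesis by (simp add: computable_def)
qed

theorem decidable_PTIME:
  assumes "decidable 0 (\<lambda>x s. x \<in> L)"
  shows "L \<in> PTIME"
proof -
  obtain c p where c: "prog 0 (\<lambda>x s. of_bool (x \<in> L)) c p"
    using computable_prog[OF assms order_refl] .
  show ?thesis
  proof (rule PTIME_I)
    fix x
    have "bounded x (\<lambda>_. 0)" by (simp add: bounded_def)
    with c obtain s' where "exec x c (\<lambda>_. 0) (poly p (length x)) s'" "s' 0 = of_bool (x \<in> L)"
      by (rule progE)
    then show "\<exists>s' t. run x c (\<lambda>_. 0) t s' \<and> t \<le> poly p (length x) \<and> (s' 0 \<noteq> 0 \<longleftrightarrow> x \<in> L)"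
      unfolding exec_def by (metis of_bool_eq_0_iff)
  qed
qed

section \<open>Deciding the manipulation problem\<close>

lemma computable_1: "computable m (\<lambda>x s. 1)"
  using computable_csuc[OF computable_0] by (simp add: csuc_def)

lemma computable_length: "computable m (\<lambda>x s. length x)"
  using computable_pred[OF computable_full] by simp

lemma iter_pred: "iter (\<lambda>_ a. a - 1) b a = a - (b :: nat)"
  by (induction b arbitrary: a) auto

text \<open>Truncated subtraction is the source of all comparisons, since e is at most f iff e - f =
  0.\<close>

lemma computable_minus:
  assumes "computable m E" "computable m F"
  shows "computable m (\<lambda>x s. E x s - F x s)"
proof -
  have "computable m (\<lambda>x s. iter (\<lambda>_ a. a - 1) (F x s) (E x s))"
    by (intro computable_iter computable_pred computable_var assms) auto
  then show ?thesis by (simp only: iter_pred)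
qed

lemma decidable_eq_0:
  assumes "computable m E"
  shows "decidable m (\<lambda>x s. E x s = 0)"
  using decidable_symb[OF assms, of "\<lambda>a. a = 3"] by simp

lemma decidable_le: "computable m E \<Longrightarrow> computable m F \<Longrightarrow> decidable m (\<lambda>x s. E x s \<le> F x s)"
  using decidable_eq_0[OF computable_minus] by simp

lemma decidable_neg: "decidable m P \<Longrightarrow> decidable m (\<lambda>x s. \<not> P x s)"
  using decidable_eq_0[of m "\<lambda>x s. of_bool (P x s)"] by simp

lemma decidable_less: "computable m E \<Longrightarrow> computable m F \<Longrightarrow> decidable m (\<lambda>x s. E x s < F x s)"
  using decidable_neg[OF decidable_le, of m F E] by (simp add: not_le)

lemma decidable_conj:
  assumes "decidable m P" "decidable m Q"
  shows "decidable m (\<lambda>x s. P x s \<and> Q x s)"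
proof -
  have "computable m (\<lambda>x s. if P x s then of_bool (Q x s) else 0)"
    by (intro computable_if computable_0 assms)
  then show ?thesis by (rule back_subst[of "computable m"]) (auto simp: fun_eq_iff)
qed

lemma decidable_disj: "decidable m P \<Longrightarrow> decidable m Q \<Longrightarrow> decidable m (\<lambda>x s. P x s \<or> Q x s)"
  using decidable_neg[OF decidable_conj[OF decidable_neg decidable_neg], of m P Q] by simp

lemma decidable_imp: "decidable m P \<Longrightarrow> decidable m Q \<Longrightarrow> decidable m (\<lambda>x s. P x s \<longrightarrow> Q x s)"
  unfolding imp_conv_disj by (intro decidable_disj decidable_neg)

lemma decidable_eq:
  assumes "computable m E" "computable m F"
  shows "decidable m (\<lambda>x s. E x s = F x s)"
proof -
  have "decidable m (\<lambda>x s. E x s \<le> F x s \<and> F x s \<le> E x s)"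
    by (intro decidable_conj decidable_le assms)
  then show ?thesis by (simp only: order_eq_iff[symmetric])
qed

lemma decidable_iff: "decidable m P \<Longrightarrow> decidable m Q \<Longrightarrow> decidable m (\<lambda>x s. P x s \<longleftrightarrow> Q x s)"
  using decidable_eq[of m "\<lambda>x s. of_bool (P x s)" "\<lambda>x s. of_bool (Q x s)"] by (simp add: of_bool_eq_iff)

lemma iter_ex: "iter (\<lambda>k a. if P k then 1 else a) n a = (if \<exists>k<n. P k then 1 else (a :: nat))"
  by (induction n arbitrary: a) (auto simp: less_Suc_eq)

lemma decidable_ex:
  assumes "computable m N"
    and "\<And>k. m \<le> k \<Longrightarrow> decidable (Suc (Suc k)) (\<lambda>x s. P x s (s (Suc k)))"
    and "\<And>x s s' v. (\<And>i. i < m \<Longrightarrow> s i = s' i) \<Longrightarrow> P x s v = P x s' v"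
  shows "decidable m (\<lambda>x s. \<exists>k<N x s. P x s k)"
proof -
  have "computable m (\<lambda>x s. iter (\<lambda>k a. if P x s k then 1 else a) (N x s) 0)"
  proof (intro computable_iter computable_if computable_0 computable_1 computable_var assms(1,2))
    fix x u v and s s' :: "nat \<Rightarrow> nat"
    assume "\<And>i. i < m \<Longrightarrow> s i = s' i"
    then have "P x s u = P x s' u" by (rule assms(3))
    then show "(if P x s u then 1 else v) = (if P x s' u then 1 else v)" by simp
  qed auto
  then show ?thesis by (simp only: iter_ex of_bool_def)
qed

lemma decidable_all:
  assumes "computable m N"
    and "\<And>k. m \<le> k \<Longrightarrow> decidable (Suc (Suc k)) (\<lambda>x s. P x s (s (Suc k)))"
    and "\<And>x s s' v. (\<And>i. i < m \<Longrightarrow> s i = s' i) \<Longrightarrow> P x s v = P x s' v"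
  shows "decidable m (\<lambda>x s. \<forall>k<N x s. P x s k)"
proof -
  have "decidable m (\<lambda>x s. \<not> (\<exists>k<N x s. \<not> P x s k))"
    by (intro decidable_neg decidable_ex assms(1,2) arg_cong[where f = Not] assms(3))
  then show ?thesis by simp
qed

section \<open>Saturating counters and halving\<close>

text \<open>The count is added to a start value \<open>a\<close>, so that several counts can be
  chained into one total.\<close>

definition tally :: "bool list \<Rightarrow> nat \<Rightarrow> (nat \<Rightarrow> bool) \<Rightarrow> nat \<Rightarrow> nat" where
  "tally x n P a = iter (\<lambda>k a. if P k then csuc x a else a) n a"

lemma computable_tally:
  assumes "computable m N" "computable m A"
    and "\<And>k. m \<le> k \<Longrightarrow> decidable (Suc (Suc k)) (\<lambda>x s. P x s (s (Suc k)))"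
    and "\<And>x s s' v. (\<And>i. i < m \<Longrightarrow> s i = s' i) \<Longrightarrow> P x s v = P x s' v"
  shows "computable m (\<lambda>x s. tally x (N x s) (P x s) (A x s))"
  unfolding tally_def
proof (intro computable_iter computable_if computable_csuc computable_var assms(1,2,3))
  fix x u v and s s' :: "nat \<Rightarrow> nat"
  assume "\<And>i. i < m \<Longrightarrow> s i = s' i"
  then have "P x s u = P x s' u" by (rule assms(4))
  then show "(if P x s u then csuc x v else v) = (if P x s' u then csuc x v else v)" by simp
qed auto

text \<open>The counter only grows, so if the final total fits into a register, \<open>csuc\<close>
  never saturates on the way.\<close>

lemma tally_eq:
  assumes "a + card {k. k < n \<and> P k} \<le> Suc (length x)"
  shows "tally x n P a = a + card {k. k < n \<and> P k}"
  using assms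
proof (induction n arbitrary: a)
  case (Suc n)
  have eq: "{k. k < Suc n \<and> P k} = (if P n then insert n {k. k < n \<and> P k} else {k. k < n \<and> P k})"
    by (auto simp: less_Suc_eq)
  have card: "card {k. k < Suc n \<and> P k} = of_bool (P n) + card {k. k < n \<and> P k}"
    unfolding eq by simp
  have step: "tally x (Suc n) P a = tally x n P (if P n then csuc x a else a)"
    by (simp only: tally_def iter.simps)
  show ?case
  proof (cases "P n")
    case True
    then have "csuc x a = Suc a" using Suc.prems card by (simp add: csuc_def)
    then show ?thesis using Suc.IH[of "Suc a"] Suc.prems card step True by simp
  next
    case False
    then show ?thesis using Suc.IH[of a] Suc.prems card step by simp
  qed
qed (simp add: tally_def)

text \<open>The test amounts to 2k + 2 \<le> v, which holds for exactly \<open>v div 2\<close>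
  values of k. It is phrased with subtraction because doubling could leave the register
  range.\<close>

definition half :: "bool list \<Rightarrow> nat \<Rightarrow> nat" where
  "half x v = tally x v (\<lambda>k. k < v - k - 1) 0"

lemma half_eq:
  assumes "v \<le> Suc (length x)"
  shows "half x v = v div 2"
proof -
  have "k < v \<and> k < v - k - 1 \<longleftrightarrow> k < v div 2" for k by presburger
  then have set: "{k. k < v \<and> k < v - k - 1} = {..<v div 2}" by auto
  have "v div 2 \<le> Suc (length x)" using assms by simp
  then show ?thesis unfolding half_def by (subst tally_eq; unfold set; simp)
qed

text \<open>Functions are treated once with registers as arguments; the \<open>_app\<close> lemmas
  then admit arbitrary computable arguments by storing them first.\<close>

definition computable1 :: "(bool list \<Rightarrow> nat \<Rightarrow> nat) \<Rightarrow> bool" where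
  "computable1 f \<longleftrightarrow> (\<forall>m a. a < m \<longrightarrow> computable m (\<lambda>x s. f x (s a)))"

definition computable2 :: "(bool list \<Rightarrow> nat \<Rightarrow> nat \<Rightarrow> nat) \<Rightarrow> bool" where
  "computable2 f \<longleftrightarrow> (\<forall>m a b. a < m \<longrightarrow> b < m \<longrightarrow> computable m (\<lambda>x s. f x (s a) (s b)))"

definition computable3 :: "(bool list \<Rightarrow> nat \<Rightarrow> nat \<Rightarrow> nat \<Rightarrow> nat) \<Rightarrow> bool" where
  "computable3 f \<longleftrightarrow> (\<forall>m a b c. a < m \<longrightarrow> b < m \<longrightarrow> c < m \<longrightarrow>
     computable m (\<lambda>x s. f x (s a) (s b) (s c)))"

lemma computable1_app:
  assumes "computable1 f" "computable m E"
  shows "computable m (\<lambda>x s. f x (E x s))"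
  by (rule computable_let[OF assms(2), where F = "\<lambda>x s. f x"]) (use assms in \<open>auto simp: computable1_def\<close>)

lemma computable2_app:
  assumes f: "computable2 f" and E: "computable m E" and F: "computable m F"
  shows "computable m (\<lambda>x s. f x (E x s) (F x s))"
proof (rule computable_let[OF E, where F = "\<lambda>x s a. f x a (F x s)"])
  fix k
  assume k: "m \<le> k"
  show "computable (Suc k) (\<lambda>x s. f x (s k) (F x s))"
  proof (rule computable_let[where F = "\<lambda>x s. f x (s k)"])
    show "computable (Suc k) F" using computable_weaken[OF F] k by simp
  qed (use f in \<open>auto simp: computable2_def\<close>)
next
  fix x v and s s' :: "nat \<Rightarrow> nat"
  assume "\<And>i. i < m \<Longrightarrow> s i = s' i"
  then show "f x v (F x s) = f x v (F x s')" by (intro arg_cong[where f = "f x v"] computable_indep[OF F])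
qed

lemma computable3_app:
  assumes f: "computable3 f" and E: "computable m E" and F: "computable m F" and G: "computable m G"
  shows "computable m (\<lambda>x s. f x (E x s) (F x s) (G x s))"
proof (rule computable_let[OF E, where F = "\<lambda>x s a. f x a (F x s) (G x s)"])
  fix k
  assume k: "m \<le> k"
  show "computable (Suc k) (\<lambda>x s. f x (s k) (F x s) (G x s))"
  proof (rule computable_let[where F = "\<lambda>x s a. f x (s k) a (G x s)"])
    show "computable (Suc k) F" using computable_weaken[OF F] k by simp
    fix j
    assume j: "Suc k \<le> j"
    show "computable (Suc j) (\<lambda>x s. f x (s k) (s j) (G x s))"
    proof (rule computable_let[where F = "\<lambda>x s. f x (s k) (s j)"])
      show "computable (Suc j) G" using computable_weaken[OF G] k j by simp
    qed (use f j in \<open>auto simp: computable3_def\<close>)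
  next
    fix x v and s s' :: "nat \<Rightarrow> nat"
    assume s: "\<And>i. i < Suc k \<Longrightarrow> s i = s' i"
    then have "G x s = G x s'" using k by (intro computable_indep[OF G]) simp
    then show "f x (s k) v (G x s) = f x (s' k) v (G x s')" using s by simp
  qed
next
  fix x v and s s' :: "nat \<Rightarrow> nat"
  assume "\<And>i. i < m \<Longrightarrow> s i = s' i"
  then have "F x s = F x s'" "G x s = G x s'"
    by (intro computable_indep[OF F] computable_indep[OF G]; simp)+
  then show "f x v (F x s) (G x s) = f x v (F x s') (G x s')" by simp
qed

section \<open>Scanning an encoded instance\<close>

definition one_at :: "bool list \<Rightarrow> nat \<Rightarrow> bool" where
  "one_at x v \<longleftrightarrow> symb x v = 2"

definition zero_at :: "bool list \<Rightarrow> nat \<Rightarrow> bool" where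
  "zero_at x v \<longleftrightarrow> symb x v = 1"

lemma decidable_one_at: "computable m E \<Longrightarrow> decidable m (\<lambda>x s. one_at x (E x s))"
  unfolding one_at_def by (rule decidable_symb)

lemma decidable_zero_at: "computable m E \<Longrightarrow> decidable m (\<lambda>x s. zero_at x (E x s))"
  unfolding zero_at_def by (rule decidable_symb)

lemmas computable_intros =
  computable_0 computable_1 computable_length computable_csuc computable_minus computable_if
  computable_iter computable_tally computable_var
  decidable_le decidable_less decidable_neg decidable_conj decidable_disj decidable_imp
  decidable_iff decidable_ex decidable_all decidable_one_at decidable_zero_at

lemma computable1_half: "computable1 half"
  unfolding half_def computable1_def by (intro allI impI computable_intros) auto

text \<open>
  Input positions are counted from 1, as the marker occupies cell 0. A parser maps the position where
  an encoded item starts to the one behind it, and to 0 if there is no such item.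
\<close>

definition next_item :: "(bool list \<Rightarrow> nat \<Rightarrow> nat) \<Rightarrow> bool list \<Rightarrow> nat \<Rightarrow> nat" where
  "next_item f x a = (if one_at x a then f x (csuc x a) else a)"

definition nth_item :: "(bool list \<Rightarrow> nat \<Rightarrow> nat) \<Rightarrow> bool list \<Rightarrow> nat \<Rightarrow> nat \<Rightarrow> nat" where
  "nth_item f x p k = iter (\<lambda>_. next_item f x) k p"

lemma computable1_next_item:
  assumes "computable1 f" shows "computable1 (next_item f)"
  unfolding next_item_def computable1_def by (intro allI impI computable_intros computable1_app[OF assms])

lemma computable2_nth_item:
  assumes "computable1 f" shows "computable2 (nth_item f)"
  unfolding nth_item_def computable2_def
  by (intro allI impI computable_intros computable1_app[OF computable1_next_item[OF assms]]) auto

text \<open>Every item takes at least its announcing bit, so \<open>length x\<close> rounds reach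
  the closing \<open>False\<close>; surplus rounds stay there, because \<open>next_item\<close>
  moves only on \<open>True\<close>. After a failure the position is 0, where no bit is read, and
  the result is 0 again.\<close>

definition skip_list :: "(bool list \<Rightarrow> nat \<Rightarrow> nat) \<Rightarrow> bool list \<Rightarrow> nat \<Rightarrow> nat" where
  "skip_list f x p = (let q = nth_item f x p (length x) in if zero_at x q then csuc x q else 0)"

lemma computable1_skip_list:
  assumes "computable1 f" shows "computable1 (skip_list f)"
  unfolding skip_list_def computable1_def Let_def
  by (intro allI impI computable_intros computable2_app[OF computable2_nth_item[OF assms]])

definition skip_bit :: "bool list \<Rightarrow> nat \<Rightarrow> nat" where
  "skip_bit x p = (if one_at x p \<or> zero_at x p then csuc x p else 0)"

lemma computable1_skip_bit: "computable1 skip_bit"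
  unfolding skip_bit_def computable1_def by (intro allI impI computable_intros)

text \<open>Leading zeros must be rejected, since \<open>enc_nat\<close> never produces them. From
  the position \<open>q\<close> behind the number, one step back is the closing \<open>False\<close>
  and two steps back the most significant digit; a length of at most 1 is the encoding of zero, or a
  failure with \<open>q = 0\<close>.\<close>

definition skip_nat :: "bool list \<Rightarrow> nat \<Rightarrow> nat" where
  "skip_nat x p = (let q = skip_list skip_bit x p in if q - p \<le> 1 \<or> one_at x (q - 1 - 1) then q else 0)"

lemma computable1_skip_nat: "computable1 skip_nat"
  unfolding skip_nat_def computable1_def Let_def
  by (intro allI impI computable_intros computable1_app[OF computable1_skip_list[OF computable1_skip_bit]])

definition skip_vote :: "bool list \<Rightarrow> nat \<Rightarrow> nat" where
  "skip_vote x p = skip_list skip_nat x (skip_nat x p)"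

lemma computable1_skip_vote: "computable1 skip_vote"
  unfolding skip_vote_def computable1_def
  by (intro allI impI computable_intros computable1_app[OF computable1_skip_list[OF computable1_skip_nat]]
      computable1_app[OF computable1_skip_nat])

definition item :: "(bool list \<Rightarrow> nat \<Rightarrow> nat) \<Rightarrow> bool list \<Rightarrow> nat \<Rightarrow> nat \<Rightarrow> nat" where
  "item f x p k = csuc x (nth_item f x p k)"

definition has_item :: "(bool list \<Rightarrow> nat \<Rightarrow> nat) \<Rightarrow> bool list \<Rightarrow> nat \<Rightarrow> nat \<Rightarrow> bool" where
  "has_item f x p k \<longleftrightarrow> one_at x (nth_item f x p k)"

lemma computable_item:
  assumes "computable1 f" "computable m E" "computable m F"
  shows "computable m (\<lambda>x s. item f x (E x s) (F x s))"
  unfolding item_def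
  by (intro computable_intros computable2_app[OF computable2_nth_item] assms)

lemma decidable_has_item:
  assumes "computable1 f" "computable m E" "computable m F"
  shows "decidable m (\<lambda>x s. has_item f x (E x s) (F x s))"
  unfolding has_item_def
  by (intro computable_intros computable2_app[OF computable2_nth_item] assms)

lemmas item_intros =
  computable_item[OF computable1_skip_bit] computable_item[OF computable1_skip_nat]
  computable_item[OF computable1_skip_vote] decidable_has_item[OF computable1_skip_bit]
  decidable_has_item[OF computable1_skip_nat] decidable_has_item[OF computable1_skip_vote]

text \<open>Missing digits read as 0, so numbers of different length can be aligned by
  column.\<close>

definition digit :: "bool list \<Rightarrow> nat \<Rightarrow> nat \<Rightarrow> bool" where
  "digit x p k \<longleftrightarrow> has_item skip_bit x p k \<and> one_at x (item skip_bit x p k)"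

lemma decidable_digit:
  "computable m E \<Longrightarrow> computable m F \<Longrightarrow> decidable m (\<lambda>x s. digit x (E x s) (F x s))"
  unfolding digit_def by (intro computable_intros item_intros)

text \<open>Candidate names are binary numbers that may exceed every register, hence the comparison
  by digits.\<close>

definition same :: "bool list \<Rightarrow> nat \<Rightarrow> nat \<Rightarrow> bool" where
  "same x p q \<longleftrightarrow> (\<forall>k<length x. digit x p k \<longleftrightarrow> digit x q k)"

lemma decidable2_same: "computable2 (\<lambda>x p q. of_bool (same x p q))"
  unfolding same_def computable2_def by (intro allI impI computable_intros decidable_digit) auto

definition member :: "bool list \<Rightarrow> nat \<Rightarrow> nat \<Rightarrow> bool" where
  "member x p a \<longleftrightarrow> (\<exists>i<length x. has_item skip_nat x p i \<and> same x (item skip_nat x p i) a)"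

lemma decidable2_member: "computable2 (\<lambda>x p q. of_bool (member x p q))"
  unfolding member_def computable2_def
  by (intro allI impI computable_intros item_intros computable2_app[OF decidable2_same]) auto

definition all_distinct :: "bool list \<Rightarrow> nat \<Rightarrow> bool" where
  "all_distinct x p \<longleftrightarrow> (\<forall>i<length x. \<forall>j<i. has_item skip_nat x p i \<and> has_item skip_nat x p j \<longrightarrow>
     \<not> same x (item skip_nat x p i) (item skip_nat x p j))"

lemma decidable1_all_distinct: "computable1 (\<lambda>x p. of_bool (all_distinct x p))"
  unfolding all_distinct_def computable1_def
  by (intro allI impI computable_intros item_intros computable2_app[OF decidable2_same]) auto

definition valid_ranking :: "bool list \<Rightarrow> nat \<Rightarrow> bool" where
  "valid_ranking x r \<longleftrightarrow> has_item skip_nat x r 0 \<and> all_distinct x r \<and>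
     (\<forall>i<length x. has_item skip_nat x r i \<longrightarrow> member x 1 (item skip_nat x r i))"

lemma decidable1_valid_ranking: "computable1 (\<lambda>x p. of_bool (valid_ranking x p))"
  unfolding valid_ranking_def computable1_def
  by (intro allI impI computable_intros item_intros computable2_app[OF decidable2_member]
      computable1_app[OF decidable1_all_distinct]) auto

definition prefers_at :: "bool list \<Rightarrow> nat \<Rightarrow> nat \<Rightarrow> nat \<Rightarrow> bool" where
  "prefers_at x r a b \<longleftrightarrow> (\<exists>i<length x. has_item skip_nat x r i \<and> same x (item skip_nat x r i) a \<and>
     (\<forall>j<length x. has_item skip_nat x r j \<and> same x (item skip_nat x r j) b \<longrightarrow> i < j))"

lemma decidable3_prefers_at: "computable3 (\<lambda>x r a b. of_bool (prefers_at x r a b))"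
  unfolding prefers_at_def computable3_def
  by (intro allI impI computable_intros item_intros computable2_app[OF decidable2_same]) auto

section \<open>The decision procedure on bit strings\<close>

definition votes_pos :: "bool list \<Rightarrow> nat" where
  "votes_pos x = skip_list skip_nat x 1"

definition weights_pos :: "bool list \<Rightarrow> nat" where
  "weights_pos x = skip_list skip_vote x (votes_pos x)"

definition preferred_pos :: "bool list \<Rightarrow> nat" where
  "preferred_pos x = skip_list skip_nat x (weights_pos x)"

lemma computable_votes_pos: "computable m (\<lambda>x s. votes_pos x)"
  unfolding votes_pos_def
  by (intro computable_intros computable1_app[OF computable1_skip_list[OF computable1_skip_nat]])

lemma computable_weights_pos: "computable m (\<lambda>x s. weights_pos x)"
  unfolding weights_pos_def
  by (intro computable_votes_pos computable1_app[OF computable1_skip_list[OF computable1_skip_vote]])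

lemma computable_preferred_pos: "computable m (\<lambda>x s. preferred_pos x)"
  unfolding preferred_pos_def
  by (intro computable_weights_pos computable1_app[OF computable1_skip_list[OF computable1_skip_nat]])

text \<open>The position behind the last number must lie beyond the input. This excludes trailing
  bits and, since failure yields 0, also every parse error.\<close>

definition well_formed :: "bool list \<Rightarrow> bool" where
  "well_formed x \<longleftrightarrow> length x < skip_nat x (preferred_pos x)"

definition valid_instance :: "bool list \<Rightarrow> bool" where
  "valid_instance x \<longleftrightarrow> all_distinct x 1 \<and> member x 1 (preferred_pos x) \<and>
     (\<forall>v<length x. has_item skip_vote x (votes_pos x) v \<longrightarrow>
       valid_ranking x (skip_nat x (item skip_vote x (votes_pos x) v)))"

lemmas skip_nat_intros = computable1_app[OF computable1_skip_nat]

lemma decidable_well_formed: "decidable m (\<lambda>x s. well_formed x)"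
  unfolding well_formed_def by (intro computable_intros skip_nat_intros computable_preferred_pos)

lemma decidable_valid_instance: "decidable m (\<lambda>x s. valid_instance x)"
  unfolding valid_instance_def
  by (intro computable_intros item_intros skip_nat_intros computable_preferred_pos computable_votes_pos
      computable1_app[OF decidable1_all_distinct] computable2_app[OF decidable2_member]
      computable1_app[OF decidable1_valid_ranking]) auto

definition supports :: "bool list \<Rightarrow> nat \<Rightarrow> nat \<Rightarrow> nat \<Rightarrow> bool" where
  "supports x a b v \<longleftrightarrow> has_item skip_vote x (votes_pos x) v \<and>
     prefers_at x (skip_nat x (item skip_vote x (votes_pos x) v)) a b"

lemma decidable3_supports: "computable3 (\<lambda>x a b v. of_bool (supports x a b v))"
  unfolding supports_def computable3_def
  by (intro allI impI computable_intros item_intros skip_nat_intros computable_votes_pos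
      computable3_app[OF decidable3_prefers_at])

text \<open>Number of subtracted weights. It is the carry into column 0 as well as the threshold for
  the final carry.\<close>

definition initial_carry :: "bool list \<Rightarrow> nat \<Rightarrow> nat \<Rightarrow> nat" where
  "initial_carry x b d = tally x (length x) (supports x b d) 0"

lemma computable2_initial_carry: "computable2 initial_carry"
  unfolding initial_carry_def computable2_def
  by (intro allI impI computable_intros computable3_app[OF decidable3_supports]) auto

text \<open>
  The supporters of \<open>b\<close> contribute complemented digits, which replaces the subtraction of their
  weights by an addition.
\<close>

definition next_carry :: "bool list \<Rightarrow> nat \<Rightarrow> nat \<Rightarrow> nat \<Rightarrow> nat \<Rightarrow> nat \<Rightarrow> nat" where
  "next_carry x b d c k a = half x
    (tally x (length x) (\<lambda>v. supports x b d v \<and> \<not> digit x (item skip_vote x (votes_pos x) v) k)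
    (tally x (length x) (\<lambda>v. supports x (preferred_pos x) c v \<and> digit x (item skip_vote x (votes_pos x) v) k)
    (tally x (length x) (\<lambda>t. has_item skip_nat x (weights_pos x) t \<and> digit x (item skip_nat x (weights_pos x) t) k) a)))"

text \<open>Reversing the index makes the loop run from column 0 upwards. With W the subtracted and
  Y the added total, A the number of subtracted weights and n columns, the full sum is A * 2^n + Y -
  W, so its carry is at least A iff W \<le> Y.\<close>

definition not_above :: "bool list \<Rightarrow> nat \<Rightarrow> nat \<Rightarrow> nat \<Rightarrow> bool" where
  "not_above x b d c \<longleftrightarrow> initial_carry x b d \<le>
     iter (\<lambda>j. next_carry x b d c (length x - 1 - j)) (length x) (initial_carry x b d)"

lemma decidable3_not_above: "computable3 (\<lambda>x b d c. of_bool (not_above x b d c))"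
  unfolding not_above_def next_carry_def computable3_def
  by (intro allI impI computable_intros item_intros computable_votes_pos computable_weights_pos
      computable_preferred_pos computable2_app[OF computable2_initial_carry]
      computable3_app[OF decidable3_supports] computable1_app[OF computable1_half] decidable_digit) auto

definition preferred_wins :: "bool list \<Rightarrow> bool" where
  "preferred_wins x \<longleftrightarrow> (\<forall>i<length x. \<forall>j<length x.
     has_item skip_nat x 1 i \<and> has_item skip_nat x 1 j \<and>
     \<not> same x (item skip_nat x 1 i) (preferred_pos x) \<and> \<not> same x (item skip_nat x 1 j) (preferred_pos x) \<longrightarrow>
     (\<exists>l<length x. has_item skip_nat x 1 l \<and> \<not> same x (item skip_nat x 1 l) (item skip_nat x 1 i) \<and>
       not_above x (item skip_nat x 1 i) (item skip_nat x 1 l) (item skip_nat x 1 j)))"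

lemma decidable_preferred_wins: "decidable m (\<lambda>x s. preferred_wins x)"
  unfolding preferred_wins_def
  by (intro computable_intros item_intros computable_preferred_pos
      computable2_app[OF decidable2_same] computable3_app[OF decidable3_not_above]) auto

section \<open>Correctness of the parsers\<close>

definition located :: "bool list \<Rightarrow> nat \<Rightarrow> bool list \<Rightarrow> bool" where
  "located x p w \<longleftrightarrow> (\<exists>u r. x = u @ w @ r \<and> p = Suc (length u))"

lemma locatedI: "located (u @ w @ r) (Suc (length u)) w"
  by (auto simp: located_def)

lemma located_appendD:
  assumes "located x p (v @ w)"
  shows "located x p v" "located x (p + length v) w"
proof -
  obtain u r where x: "x = u @ (v @ w) @ r" "p = Suc (length u)" using assms by (auto simp: located_def)
  then show "located x p v" using locatedI[of u v "w @ r"] by simp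
  show "located x (p + length v) w" using x locatedI[of "u @ v" w r] by simp
qed

lemma located_length: "located x p w \<Longrightarrow> p + length w \<le> Suc (length x)"
  by (auto simp: located_def)

lemma symb_append [simp]:
  "symb (u @ v) (Suc (length u)) = (case v of [] \<Rightarrow> 0 | b # _ \<Rightarrow> if b then 2 else 1)"
  by (cases v) (auto simp: symb_def nth_append)

lemma one_at_append [simp]: "one_at (u @ v) (Suc (length u)) \<longleftrightarrow> v \<noteq> [] \<and> hd v"
  by (cases v) (auto simp: one_at_def symb_def)

lemma zero_at_append [simp]: "zero_at (u @ v) (Suc (length u)) \<longleftrightarrow> v \<noteq> [] \<and> \<not> hd v"
  by (cases v) (auto simp: zero_at_def symb_def)

lemma at_0 [simp]: "\<not> one_at x 0" "\<not> zero_at x 0"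
  by (auto simp: one_at_def zero_at_def symb_def)

lemma csuc_append [simp]:
  "csuc (u @ v) (Suc (length u)) = (if v = [] then Suc (length u) else Suc (Suc (length u)))"
  by (cases v) (auto simp: csuc_def)

lemma at_end [simp]:
  "\<not> one_at u (Suc (length u))" "\<not> zero_at u (Suc (length u))" "csuc u (Suc (length u)) = Suc (length u)"
  by (auto simp: one_at_def zero_at_def symb_def csuc_def)

lemma located_one_at: "located x p [b] \<Longrightarrow> one_at x p \<longleftrightarrow> b"
  by (auto simp: located_def)

text \<open>Failures propagate, encodings are skipped exactly, and a nonzero result guarantees that
  an encoding was there. The last clause is what recognising malformed inputs rests on.\<close>

definition parses :: "(bool list \<Rightarrow> nat \<Rightarrow> nat) \<Rightarrow> ('a \<Rightarrow> bool list) \<Rightarrow> bool" where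
  "parses f enc \<longleftrightarrow> (\<forall>x. f x 0 = 0) \<and>
     (\<forall>x p y. located x p (enc y) \<longrightarrow> f x p = p + length (enc y)) \<and>
     (\<forall>u v. f (u @ v) (Suc (length u)) \<noteq> 0 \<longrightarrow> (\<exists>y r. v = enc y @ r))"

lemma parses_0: "parses f enc \<Longrightarrow> f x 0 = 0"
  by (simp add: parses_def)

lemma parses_located: "parses f enc \<Longrightarrow> located x p (enc y) \<Longrightarrow> f x p = p + length (enc y)"
  by (simp add: parses_def)

lemma parses_append: "parses f enc \<Longrightarrow> f (u @ enc y @ r) (Suc (length u)) = Suc (length (u @ enc y))"
  using parses_located[OF _ locatedI] by fastforce

lemma parsesD: "parses f enc \<Longrightarrow> f (u @ v) (Suc (length u)) \<noteq> 0 \<Longrightarrow> \<exists>y r. v = enc y @ r"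
  by (simp add: parses_def)

text \<open>\<open>enc_list\<close> without its terminator, so that it distributes over
  \<open>@\<close> and the input can be split at the k-th item.\<close>

definition items :: "('a \<Rightarrow> bool list) \<Rightarrow> 'a list \<Rightarrow> bool list" where
  "items enc ys = concat (map (\<lambda>y. True # enc y) ys)"

lemma items_simps [simp]:
  "items enc [] = []" "items enc (y # ys) = True # enc y @ items enc ys"
  "items enc (ys @ zs) = items enc ys @ items enc zs"
  by (simp_all add: items_def)

lemma enc_list_items: "enc_list enc ys = items enc ys @ [False]"
  by (simp add: enc_list_def items_def)

lemma length_items: "length ys \<le> length (items enc ys)"
  by (induction ys) auto

lemma nth_item_0 [simp]: "nth_item f x p 0 = p"
  by (simp add: nth_item_def)

lemma nth_item_Suc: "nth_item f x p (Suc k) = nth_item f x (next_item f x p) k"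
  by (simp add: nth_item_def)

lemma nth_item_add: "nth_item f x p (j + k) = nth_item f x (nth_item f x p j) k"
  by (induction j arbitrary: p) (simp_all add: nth_item_Suc)

lemma nth_item_stay: "\<not> one_at x p \<Longrightarrow> nth_item f x p k = p"
  by (induction k) (simp_all add: nth_item_Suc next_item_def)

lemma next_item_append:
  assumes "parses f enc"
  shows "next_item f (u @ True # enc y @ r) (Suc (length u)) = Suc (length (u @ True # enc y))"
  using parses_append[OF assms, of "u @ [True]" y r] by (simp add: next_item_def)

lemma nth_item_items:
  assumes "parses f enc"
  shows "k \<le> length ys \<Longrightarrow>
    nth_item f (u @ items enc ys @ r) (Suc (length u)) k = Suc (length (u @ items enc (take k ys)))"
proof (induction ys arbitrary: u k)
  case (Cons y ys)
  show ?case
  proof (cases k)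
    case (Suc j)
    then show ?thesis
      using Cons.IH[of j "u @ True # enc y"] Cons.prems
        next_item_append[OF assms, of u y "items enc ys @ r"]
      by (simp add: nth_item_Suc)
  qed simp
qed simp

text \<open>Up to the end of the list each round of \<open>nth_item\<close> passes one item; from
  there on it rests on the closing \<open>False\<close>, so indices beyond the list are recognised
  as absent.\<close>

lemma has_item_located:
  assumes f: "parses f enc" and loc: "located x p (enc_list enc ys)"
  shows "has_item f x p k \<longleftrightarrow> k < length ys"
    and "k < length ys \<Longrightarrow> located x (item f x p k) (enc (ys ! k))"
proof -
  obtain u r where x: "x = u @ items enc ys @ False # r" and p: "p = Suc (length u)"
    using loc by (auto simp: located_def enc_list_items)
  have less: "nth_item f x p k = Suc (length (u @ items enc (take k ys)))" if "k \<le> length ys" for k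
    using nth_item_items[OF f that] x p by blast
  have split: "x = (u @ items enc (take k ys)) @ True # enc (ys ! k) @ items enc (drop (Suc k) ys) @ False # r"
    if "k < length ys" for k
  proof -
    have "items enc ys = items enc (take k ys @ ys ! k # drop (Suc k) ys)"
      using id_take_nth_drop[OF that] by metis
    then show ?thesis unfolding x by simp
  qed
  show "located x (item f x p k) (enc (ys ! k))" if k: "k < length ys"
  proof -
    have "item f x p k = Suc (length ((u @ items enc (take k ys)) @ [True]))"
      unfolding item_def less[OF less_imp_le[OF k]]
      by (subst split[OF k], subst csuc_append) simp
    then show ?thesis
      using locatedI[of "(u @ items enc (take k ys)) @ [True]" "enc (ys ! k)"] split[OF k]
      by simp
  qed
  show "has_item f x p k \<longleftrightarrow> k < length ys"
  proof (cases "k < length ys")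
    case True
    then show ?thesis
      unfolding has_item_def less[OF less_imp_le[OF True]]
      by (subst split[OF True], subst one_at_append) simp
  next
    case False
    have stop: "\<not> one_at x (Suc (length (u @ items enc ys)))"
      using one_at_append[of "u @ items enc ys" "False # r"] by (simp add: x)
    have "nth_item f x p k = nth_item f x (nth_item f x p (length ys)) (k - length ys)"
      using False by (simp flip: nth_item_add)
    also have "\<dots> = Suc (length (u @ items enc ys))"
      using less[of "length ys"] nth_item_stay[OF stop] by simp
    finally show ?thesis using stop False by (simp add: has_item_def)
  qed
qed

lemma parses_skip_list:
  assumes f: "parses f enc"
  shows "parses (skip_list f) (enc_list enc)"
proof -
  have "skip_list f x 0 = 0" for x
    by (simp add: skip_list_def nth_item_stay)
  moreover have "skip_list f x p = p + length (enc_list enc ys)" if loc: "located x p (enc_list enc ys)" for x p ys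
  proof -
    obtain u r where x: "x = u @ items enc ys @ False # r" and p: "p = Suc (length u)"
      using loc by (auto simp: located_def enc_list_items)
    have x': "x = (u @ items enc ys) @ False # r" by (simp add: x)
    let ?q = "Suc (length (u @ items enc ys))"
    have stop: "\<not> one_at x ?q" "zero_at x ?q" and suc: "csuc x ?q = Suc ?q"
      unfolding x' one_at_append zero_at_append csuc_append by simp_all
    have len: "length ys \<le> length x" using length_items[of ys enc] by (simp add: x)
    have "nth_item f x p (length x) = nth_item f x (nth_item f x p (length ys)) (length x - length ys)"
      using len by (simp flip: nth_item_add)
    also have "nth_item f x p (length ys) = ?q"
      using nth_item_items[OF f order_refl, of u ys "False # r"] x p by simp
    also have "nth_item f x ?q (length x - length ys) = ?q" by (rule nth_item_stay[OF stop(1)])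
    finally show ?thesis using stop suc by (simp add: skip_list_def Let_def p enc_list_items)
  qed
  moreover have "\<exists>ys r. v = enc_list enc ys @ r" if "skip_list f (u @ v) (Suc (length u)) \<noteq> 0" for u v
  proof -
    \<comment> \<open>Generalised to any number of rounds and any start, so that induction can peel
      off one item. If the item parser fails, position 0 is kept and \<open>zero_at\<close> cannot
      hold.\<close>
    have "\<exists>ys r. v = items enc ys @ False # r"
      if "zero_at (u @ v) (nth_item f (u @ v) (Suc (length u)) k)" for k u v
      using that
    proof (induction k arbitrary: u v)
      case 0
      then obtain r where "v = False # r" using zero_at_append[of u v] by (cases v) auto
      then have "v = items enc [] @ False # r" by simp
      then show ?case by blast
    next
      case (Suc k)
      show ?case
      proof (cases "one_at (u @ v) (Suc (length u))")
        case False
        then show ?thesis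
          using Suc.IH[of u v] Suc.prems by (simp only: nth_item_Suc next_item_def if_False)
      next
        case True
        then obtain w where v: "v = True # w" by (cases v) auto
        have nxt: "next_item f (u @ v) (Suc (length u)) = f ((u @ [True]) @ w) (Suc (length (u @ [True])))"
          using True by (simp add: next_item_def v)
        show ?thesis
        proof (cases "f ((u @ [True]) @ w) (Suc (length (u @ [True]))) = 0")
          case True
          then show ?thesis using Suc.prems nxt by (simp add: nth_item_Suc nth_item_stay)
        next
          case False
          then obtain y r where w: "w = enc y @ r" using parsesD[OF f] by blast
          have "nth_item f (u @ v) (Suc (length u)) (Suc k)
              = nth_item f ((u @ True # enc y) @ r) (Suc (length (u @ True # enc y))) k"
            using next_item_append[OF f, of u y r] by (simp add: nth_item_Suc v w)
          then obtain ys r' where "r = items enc ys @ False # r'"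
            using Suc.IH[of "u @ True # enc y" r] Suc.prems v w by auto
          then show ?thesis using v w by (intro exI[of _ "y # ys"]) simp
        qed
      qed
    qed
    then show ?thesis using that by (fastforce simp: skip_list_def Let_def enc_list_items split: if_splits)
  qed
  ultimately show ?thesis by (simp add: parses_def)
qed

lemma parses_skip_bit: "parses skip_bit (\<lambda>b. [b])"
proof -
  have "\<exists>b r. v = [b] @ r" if "skip_bit (u @ v) (Suc (length u)) \<noteq> 0" for u v
    using that one_at_append[of u v] zero_at_append[of u v] by (cases v) (auto simp: skip_bit_def)
  then show ?thesis by (auto simp: parses_def skip_bit_def located_def)
qed

text \<open>Together with \<open>last_bits\<close> this characterises the range of
  \<open>bits\<close>, which is why checking the last digit in \<open>skip_nat\<close>
  suffices.\<close>

lemma ex_bits: "bs = [] \<or> last bs \<Longrightarrow> \<exists>m. bits m = bs"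
proof (induction bs)
  case Nil
  then show ?case by (intro exI[of _ 0]) (simp add: bits.simps)
next
  case (Cons b bs)
  then obtain m where m: "bits m = bs" by (auto split: if_splits)
  have "m \<noteq> 0 \<or> b" using Cons.prems m by (cases "m = 0") (auto simp: bits.simps[of 0])
  then have "bits (2 * m + of_bool b) = b # bs" using m by (subst bits.simps) auto
  then show ?case by blast
qed

lemma last_bits: "bits m \<noteq> [] \<Longrightarrow> last (bits m)"
proof (induction m rule: less_induct)
  case (less m)
  then have "m \<noteq> 0" by (metis bits.simps)
  then have eq: "bits m = odd m # bits (m div 2)" by (simp add: bits.simps[of m])
  show ?case
  proof (cases "m div 2 = 0")
    case True
    then have "odd m" using \<open>m \<noteq> 0\<close> by presburger
    then show ?thesis unfolding eq True by (simp add: bits.simps[of 0])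
  next
    case False
    then have "bits (m div 2) \<noteq> []" by (simp add: bits.simps[of "m div 2"])
    then show ?thesis using less.IH[of "m div 2"] \<open>m \<noteq> 0\<close> by (simp add: eq)
  qed
qed

lemma nth_bits: "k < length (bits m) \<and> bits m ! k \<longleftrightarrow> odd (m div 2 ^ k)"
proof (induction k arbitrary: m)
  case 0
  then show ?case by (auto simp: bits.simps[of m])
next
  case (Suc k)
  show ?case
  proof (cases "m = 0")
    case False
    then have "bits m = odd m # bits (m div 2)" by (simp add: bits.simps[of m])
    then show ?thesis using Suc[of "m div 2"] by (simp add: div_mult2_eq)
  qed (simp add: bits.simps)
qed

lemma less_two_power_bits: "m < 2 ^ length (bits m)"
proof (induction m rule: less_induct)
  case (less m)
  show ?case
  proof (cases "m = 0")
    case False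
    then have "bits m = odd m # bits (m div 2)" by (simp add: bits.simps[of m])
    then show ?thesis using less[of "m div 2"] False by simp
  qed simp
qed

lemma length_items_bits: "length (items (\<lambda>b. [b]) bs) = 2 * length bs"
  by (induction bs) auto

lemma parses_skip_nat: "parses skip_nat enc_nat"
proof -
  note P = parses_skip_list[OF parses_skip_bit]
  have ends: "one_at (u @ items (\<lambda>b. [b]) (cs @ [b]) @ r)
      (Suc (length u) + length (enc_list (\<lambda>b. [b]) (cs @ [b])) - 1 - 1) \<longleftrightarrow> b" for u cs b r
  proof -
    have "Suc (length u) + length (enc_list (\<lambda>b. [b]) (cs @ [b])) - 1 - 1
        = Suc (length (u @ items (\<lambda>b. [b]) cs @ [True]))"
      by (simp add: enc_list_items)
    then show ?thesis using one_at_append[of "u @ items (\<lambda>b. [b]) cs @ [True]" "b # r"] by simp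
  qed
  have "skip_nat x 0 = 0" for x
    by (simp add: skip_nat_def parses_0[OF P])
  moreover have "skip_nat x p = p + length (enc_nat m)" if loc: "located x p (enc_nat m)" for x p m
  proof -
    have q: "skip_list skip_bit x p = p + length (enc_nat m)"
      using parses_located[OF P] loc unfolding enc_nat_def by blast
    have "length (enc_nat m) \<le> 1 \<or> one_at x (p + length (enc_nat m) - 1 - 1)"
    proof (cases "bits m = []")
      case True
      then show ?thesis by (simp add: enc_nat_def enc_list_items)
    next
      case False
      then obtain cs where cs: "bits m = cs @ [True]"
        using last_bits append_butlast_last_id[OF False] by metis
      obtain u r where "x = u @ items (\<lambda>b. [b]) (cs @ [True]) @ False # r" "p = Suc (length u)"
        using loc cs by (auto simp: located_def enc_nat_def enc_list_items)
      then show ?thesis using ends[of u cs True] by (simp only: enc_nat_def cs) simp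
    qed
    then show ?thesis by (auto simp: skip_nat_def Let_def q)
  qed
  moreover have "\<exists>m r. v = enc_nat m @ r" if nz: "skip_nat (u @ v) (Suc (length u)) \<noteq> 0" for u v
  proof -
    have nz': "skip_list skip_bit (u @ v) (Suc (length u)) \<noteq> 0"
      using nz by (auto simp: skip_nat_def Let_def split: if_splits)
    then obtain bs r where v: "v = enc_list (\<lambda>b. [b]) bs @ r" using parsesD[OF P] by blast
    have q: "skip_list skip_bit (u @ v) (Suc (length u)) = Suc (length u) + length (enc_list (\<lambda>b. [b]) bs)"
      using parses_append[OF P, of u bs r] v by simp
    have "bs = [] \<or> last bs"
    proof (cases bs rule: rev_cases)
      case (snoc cs b)
      have "one_at (u @ v) (Suc (length u) + length (enc_list (\<lambda>b. [b]) bs) - 1 - 1)"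
        using nz unfolding skip_nat_def Let_def q
        by (auto simp: snoc enc_list_items split: if_splits)
      then show ?thesis using ends[of u cs b "False # r"] by (simp add: v snoc enc_list_items)
    qed simp
    then obtain m where "bits m = bs" using ex_bits by blast
    then show ?thesis using v by (auto simp: enc_nat_def)
  qed
  ultimately show ?thesis unfolding parses_def by blast
qed

lemma parses_skip_vote: "parses skip_vote enc_vote"
proof -
  note P = parses_skip_list[OF parses_skip_nat]
  have "skip_vote x 0 = 0" for x
    by (simp add: skip_vote_def parses_0[OF P] parses_0[OF parses_skip_nat])
  moreover have "skip_vote x p = p + length (enc_vote v)" if "located x p (enc_vote v)" for x p v
    using located_appendD[OF that[unfolded enc_vote_def]] parses_located[OF P] parses_located[OF parses_skip_nat]
    by (simp add: skip_vote_def enc_vote_def)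
  moreover have "\<exists>y r. v = enc_vote y @ r" if nz: "skip_vote (u @ v) (Suc (length u)) \<noteq> 0" for u v
  proof -
    have "skip_nat (u @ v) (Suc (length u)) \<noteq> 0"
      using nz parses_0[OF P] by (metis skip_vote_def)
    then obtain m r where v: "v = enc_nat m @ r" using parsesD[OF parses_skip_nat] by blast
    then have "skip_list skip_nat ((u @ enc_nat m) @ r) (Suc (length (u @ enc_nat m))) \<noteq> 0"
      using nz parses_append[OF parses_skip_nat, of u m r] by (simp add: skip_vote_def)
    then obtain ys r' where "r = enc_list enc_nat ys @ r'" using parsesD[OF P] by blast
    then show ?thesis using v by (intro exI[of _ "(m, ys)"] exI[of _ r']) (simp add: enc_vote_def)
  qed
  ultimately show ?thesis unfolding parses_def by blast
qed

lemma digit_iff: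
  assumes "located x p (enc_nat m)"
  shows "digit x p k \<longleftrightarrow> odd (m div 2 ^ k)"
  using has_item_located[OF parses_skip_bit assms[unfolded enc_nat_def], of k] located_one_at nth_bits[of k m]
  by (auto simp: digit_def)

text \<open>Consequently \<open>length x\<close> columns hold all digits of every number in the
  input.\<close>

lemma located_less_two_power:
  assumes "located x p (enc_nat m)"
  shows "m < 2 ^ length x"
proof -
  have "length (bits m) \<le> length x"
    using located_length[OF assms] length_items_bits[of "bits m"] assms
    by (auto simp: enc_nat_def enc_list_items located_def)
  then have "(2 :: nat) ^ length (bits m) \<le> 2 ^ length x" by (rule power_increasing) simp
  then show ?thesis using less_two_power_bits[of m] by linarith
qed

lemma same_iff:
  assumes "located x p (enc_nat a)" "located x q (enc_nat b)"
  shows "same x p q \<longleftrightarrow> a = b"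
proof
  assume s: "same x p q"
  have "odd (a div 2 ^ k) \<longleftrightarrow> odd (b div 2 ^ k)" for k
  proof (cases "k < length x")
    case True
    then show ?thesis using s by (simp add: same_def digit_iff[OF assms(1)] digit_iff[OF assms(2)])
  next
    case False
    then have "(2 :: nat) ^ length x \<le> 2 ^ k" by (intro power_increasing) auto
    then have "a < 2 ^ k" "b < 2 ^ k"
      using located_less_two_power[OF assms(1)] located_less_two_power[OF assms(2)] by linarith+
    then show ?thesis by simp
  qed
  then show "a = b" by (simp add: bit_eq_iff bit_iff_odd)
qed (simp add: same_def digit_iff[OF assms(1)] digit_iff[OF assms(2)])

lemma located_length_list:
  assumes "located x p (enc_list enc ys)"
  shows "length ys < length x"
  using assms length_items[of ys enc] by (auto simp: located_def enc_list_items)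

lemma ex_item:
  assumes "parses f enc" "located x p (enc_list enc ys)"
  shows "(\<exists>i<length x. has_item f x p i \<and> P i) \<longleftrightarrow> (\<exists>i<length ys. P i)"
  using has_item_located(1)[OF assms] located_length_list[OF assms(2)] by (auto intro: less_trans)

lemma all_items:
  assumes "parses f enc" "located x p (enc_list enc ys)"
  shows "(\<forall>i<length x. has_item f x p i \<longrightarrow> P i) \<longleftrightarrow> (\<forall>i<length ys. P i)"
  using has_item_located(1)[OF assms] located_length_list[OF assms(2)] by (auto intro: less_trans)

lemmas nat_items = has_item_located[OF parses_skip_nat]

lemma member_iff:
  assumes L: "located x p (enc_list enc_nat L)" and a: "located x q (enc_nat a)"
  shows "member x p q \<longleftrightarrow> a \<in> set L"
proof -
  have "member x p q \<longleftrightarrow> (\<exists>i<length L. L ! i = a)"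
    unfolding member_def ex_item[OF parses_skip_nat L]
    by (simp add: same_iff[OF nat_items(2)[OF L] a] cong: conj_cong)
  then show ?thesis by (auto simp: in_set_conv_nth)
qed

lemma all_distinct_iff:
  assumes L: "located x p (enc_list enc_nat L)"
  shows "all_distinct x p \<longleftrightarrow> distinct L"
proof -
  have "all_distinct x p \<longleftrightarrow> (\<forall>i<length L. \<forall>j<i. L ! i \<noteq> L ! j)"
    using located_length_list[OF L]
    by (auto simp: all_distinct_def nat_items(1)[OF L] same_iff[OF nat_items(2)[OF L] nat_items(2)[OF L]])
  also have "\<dots> \<longleftrightarrow> distinct L"
    unfolding distinct_conv_nth
  proof (intro iffI allI impI)
    fix i j
    assume H: "\<forall>i<length L. \<forall>j<i. L ! i \<noteq> L ! j" and ij: "i < length L" "j < length L" "i \<noteq> j"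
    then show "L ! i \<noteq> L ! j"
      by (metis linorder_neqE_nat)
  qed auto
  finally show ?thesis .
qed

lemma valid_ranking_iff:
  assumes r: "located x p (enc_list enc_nat r)" and C: "located x 1 (enc_list enc_nat C)"
  shows "valid_ranking x p \<longleftrightarrow> top_truncated (set C) r"
proof -
  have "valid_ranking x p \<longleftrightarrow> r \<noteq> [] \<and> distinct r \<and> (\<forall>i<length r. r ! i \<in> set C)"
    unfolding valid_ranking_def all_items[OF parses_skip_nat r]
    by (simp add: nat_items(1)[OF r] all_distinct_iff[OF r] member_iff[OF C nat_items(2)[OF r]] del: One_nat_def)
  moreover have "(\<forall>i<length r. r ! i \<in> set C) \<longleftrightarrow> set r \<subseteq> set C" by (metis in_set_conv_nth subset_iff)
  ultimately show ?thesis by (simp add: top_truncated_def)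
qed

lemma prefers_at_iff:
  assumes r: "located x p (enc_list enc_nat r)" and a: "located x q (enc_nat a)" and b: "located x q' (enc_nat b)"
  shows "prefers_at x p q q' \<longleftrightarrow> prefers r a b"
proof -
  have "prefers_at x p q q' \<longleftrightarrow> (\<exists>i<length r. r ! i = a \<and> (\<forall>j<length r. r ! j = b \<longrightarrow> i < j))"
    unfolding prefers_at_def imp_conjL ex_item[OF parses_skip_nat r] all_items[OF parses_skip_nat r]
    by (simp add: same_iff[OF nat_items(2)[OF r] a] same_iff[OF nat_items(2)[OF r] b] cong: conj_cong)
  then show ?thesis by (simp add: prefers_def)
qed

lemma located_enc_cwcm:
  assumes "x = enc_cwcm I"
  shows "located x 1 (enc_list enc_nat (candidates I))"
    "located x (votes_pos x) (enc_list enc_vote (nonmanipulators I))"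
    "located x (weights_pos x) (enc_list enc_nat (weights I))"
    "located x (preferred_pos x) (enc_nat (preferred I))"
proof -
  have loc: "located x 1 (enc_list enc_nat (candidates I) @ enc_list enc_vote (nonmanipulators I) @
     enc_list enc_nat (weights I) @ enc_nat (preferred I))"
    using locatedI[of "[]" _ "[]"] by (simp add: assms enc_cwcm_def)
  note l1 = located_appendD[OF loc]
  note l2 = located_appendD[OF l1(2)]
  note l3 = located_appendD[OF l2(2)]
  show "located x 1 (enc_list enc_nat (candidates I))" by (rule l1(1))
  have v: "votes_pos x = 1 + length (enc_list enc_nat (candidates I))"
    using parses_located[OF parses_skip_list[OF parses_skip_nat] l1(1)] by (simp add: votes_pos_def)
  show "located x (votes_pos x) (enc_list enc_vote (nonmanipulators I))" using l2(1) v by simp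
  have w: "weights_pos x = votes_pos x + length (enc_list enc_vote (nonmanipulators I))"
    using parses_located[OF parses_skip_list[OF parses_skip_vote] l2(1)] v by (simp add: weights_pos_def)
  show "located x (weights_pos x) (enc_list enc_nat (weights I))" using l3(1) v w by simp
  have "preferred_pos x = weights_pos x + length (enc_list enc_nat (weights I))"
    using parses_located[OF parses_skip_list[OF parses_skip_nat] l3(1)] v w by (simp add: preferred_pos_def)
  then show "located x (preferred_pos x) (enc_nat (preferred I))" using l3(2) v w by simp
qed

lemma well_formed_iff: "well_formed x \<longleftrightarrow> (\<exists>I. x = enc_cwcm I)"
proof
  assume "\<exists>I. x = enc_cwcm I"
  then obtain I where x: "x = enc_cwcm I" by blast
  have "preferred_pos x + length (enc_nat (preferred I)) = Suc (length x)"
  proof -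
    have loc: "located x 1 (enc_list enc_nat (candidates I) @ enc_list enc_vote (nonmanipulators I) @
       enc_list enc_nat (weights I) @ enc_nat (preferred I))"
      using locatedI[of "[]" _ "[]"] by (simp add: x enc_cwcm_def)
    note l1 = located_appendD[OF loc]
    note l2 = located_appendD[OF l1(2)]
    note l3 = located_appendD[OF l2(2)]
    show ?thesis
      using parses_located[OF parses_skip_list[OF parses_skip_nat] l1(1)]
        parses_located[OF parses_skip_list[OF parses_skip_vote] l2(1)]
        parses_located[OF parses_skip_list[OF parses_skip_nat] l3(1)]
      by (simp add: preferred_pos_def weights_pos_def votes_pos_def) (simp add: x enc_cwcm_def)
  qed
  then show "well_formed x"
    using parses_located[OF parses_skip_nat located_enc_cwcm(4)[OF x]] by (simp add: well_formed_def)
next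
  assume wf: "well_formed x"
  note P = parses_skip_list[OF parses_skip_nat] and Q = parses_skip_list[OF parses_skip_vote]
  \<comment> \<open>A failure at any stage would carry through to the last parser as 0, so the final
    success forces each of the four parts to be an encoding.\<close>
  have nz: "skip_nat x (preferred_pos x) \<noteq> 0" using wf by (simp add: well_formed_def)
  then have nz3: "preferred_pos x \<noteq> 0" using parses_0[OF parses_skip_nat] by metis
  then have nz2: "weights_pos x \<noteq> 0" using parses_0[OF P] by (metis preferred_pos_def)
  then have nz1: "votes_pos x \<noteq> 0" using parses_0[OF Q] by (metis weights_pos_def)
  have "skip_list skip_nat ([] @ x) (Suc (length [])) \<noteq> 0" using nz1 by (simp add: votes_pos_def)
  then obtain C r1 where x1: "x = enc_list enc_nat C @ r1" using parsesD[OF P] by blast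
  let ?u1 = "enc_list enc_nat C"
  have v: "votes_pos x = Suc (length ?u1)"
    using parses_append[OF P, of "[]" C r1] x1 by (simp add: votes_pos_def)
  then have "skip_list skip_vote (?u1 @ r1) (Suc (length ?u1)) \<noteq> 0"
    using nz2 x1 by (simp add: weights_pos_def)
  then obtain V r2 where r1: "r1 = enc_list enc_vote V @ r2" using parsesD[OF Q] by blast
  let ?u2 = "?u1 @ enc_list enc_vote V"
  have w: "weights_pos x = Suc (length ?u2)"
    using parses_append[OF Q, of ?u1 V r2] x1 r1 v by (simp add: weights_pos_def)
  have x2: "x = ?u2 @ r2" using x1 r1 by simp
  have "skip_list skip_nat (?u2 @ r2) (Suc (length ?u2)) \<noteq> 0"
    using nz3 x2 w by (metis preferred_pos_def)
  then obtain T r3 where r2: "r2 = enc_list enc_nat T @ r3" using parsesD[OF P] by blast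
  let ?u3 = "?u2 @ enc_list enc_nat T"
  have p: "preferred_pos x = Suc (length ?u3)"
    using parses_append[OF P, of ?u2 T r3] x2 r2 w by (metis preferred_pos_def)
  have x3: "x = ?u3 @ r3" using x2 r2 by simp
  have "skip_nat (?u3 @ r3) (Suc (length ?u3)) \<noteq> 0" using nz x3 p by metis
  then obtain m r4 where r3: "r3 = enc_nat m @ r4" using parsesD[OF parses_skip_nat] by blast
  have "skip_nat x (preferred_pos x) = Suc (length (?u3 @ enc_nat m))"
    using parses_append[OF parses_skip_nat, of ?u3 m r4] x3 r3 p by metis
  then have "r4 = []" using wf x3 r3 by (simp add: well_formed_def)
  then have "x = enc_cwcm \<lparr>candidates = C, nonmanipulators = V, weights = T, preferred = m\<rparr>"
    using x3 r3 by (simp add: enc_cwcm_def)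
  then show "\<exists>I. x = enc_cwcm I" by blast
qed

lemmas vote_items = has_item_located[OF parses_skip_vote]

lemma located_vote:
  assumes "located x p (enc_vote v)"
  shows "located x p (enc_nat (fst v))" "located x (skip_nat x p) (enc_list enc_nat (snd v))"
  using located_appendD[OF assms[unfolded enc_vote_def]]
    parses_located[OF parses_skip_nat located_appendD(1)[OF assms[unfolded enc_vote_def]]] by simp_all

lemma valid_instance_iff:
  assumes "x = enc_cwcm I"
  shows "valid_instance x \<longleftrightarrow> cwcm_instance I"
proof -
  note loc = located_enc_cwcm[OF assms]
  have "valid_instance x \<longleftrightarrow> distinct (candidates I) \<and> preferred I \<in> set (candidates I) \<and>
      (\<forall>v<length (nonmanipulators I). top_truncated (set (candidates I)) (snd (nonmanipulators I ! v)))"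
    unfolding valid_instance_def all_items[OF parses_skip_vote loc(2)]
    using all_distinct_iff[OF loc(1)] member_iff[OF loc(1) loc(4)]
    by (simp add: valid_ranking_iff[OF located_vote(2)[OF vote_items(2)[OF loc(2)]] loc(1)])
  then show ?thesis by (auto simp: cwcm_instance_def all_set_conv_all_nth case_prod_unfold)
qed

section \<open>Comparing sums of binary numbers\<close>

text \<open>Undoes the descending order of \<open>iter\<close>: with the reversed index, an ordinary
  upward induction applies.\<close>

lemma iter_invariant:
  assumes "P 0 a" and step: "\<And>k a. k < n \<Longrightarrow> P k a \<Longrightarrow> P (Suc k) (h k a)"
  shows "P n (iter (\<lambda>j. h (n - 1 - j)) n a)"
proof -
  have "m \<le> n \<Longrightarrow> P (n - m) a \<Longrightarrow> P n (iter (\<lambda>j. h (n - 1 - j)) m a)" for m a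
  proof (induction m arbitrary: a)
    case (Suc m)
    have "P (Suc (n - 1 - m)) (h (n - 1 - m) a)"
      using Suc.prems by (intro step) simp_all
    moreover have "Suc (n - 1 - m) = n - m" using Suc.prems(1) by simp
    ultimately show ?case using Suc.IH Suc.prems(1) by simp
  qed simp
  from this[of n a] show ?thesis using assms(1) by simp
qed

lemma mod_two_power_Suc: "(a :: nat) mod 2 ^ Suc k = a mod 2 ^ k + 2 ^ k * of_bool (odd (a div 2 ^ k))"
  using mod_mult2_eq[of a "2 ^ k" 2] by (simp add: mult.commute mod_2_eq_odd)

lemma sum_of_bool_card:
  assumes "finite A"
  shows "(\<Sum>i\<in>A. n * of_bool (Q i)) = n * card {i \<in> A. Q i}"
proof -
  have "(\<Sum>i\<in>A. of_bool (Q i)) = card {i \<in> A. Q i}"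
    using sum.inter_filter[OF assms, of "\<lambda>_. 1 :: nat" Q] by (simp add: of_bool_def)
  then show ?thesis by (simp flip: sum_distrib_left)
qed

context
  fixes A B C :: "nat set" and w y z :: "nat \<Rightarrow> nat"
  assumes finite: "finite A" "finite B" "finite C"
begin

text \<open>
  Adding the \<open>k\<close>-bit complement of every \<open>w i\<close> replaces a subtraction, so that a single
  non-negative carry suffices; starting from \<open>card A\<close> supplies the missing \<open>+ 1\<close> of each complement.
\<close>

definition low_sum :: "nat \<Rightarrow> nat" where
  "low_sum k = card A + (\<Sum>i\<in>A. 2 ^ k - 1 - w i mod 2 ^ k) + (\<Sum>i\<in>B. y i mod 2 ^ k) + (\<Sum>i\<in>C. z i mod 2 ^ k)"

text \<open>Digit sum of column \<open>k\<close>; on \<open>A\<close> the zeros are counted because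
  the weights enter complemented.\<close>

definition column :: "nat \<Rightarrow> nat" where
  "column k = card {i \<in> A. even (w i div 2 ^ k)} + card {i \<in> B. odd (y i div 2 ^ k)} +
     card {i \<in> C. odd (z i div 2 ^ k)}"

definition carry :: "nat \<Rightarrow> nat" where
  "carry k = low_sum k div 2 ^ k"

lemma low_sum_Suc: "low_sum (Suc k) = low_sum k + 2 ^ k * column k"
proof -
  have compl: "2 ^ Suc k - 1 - (a mod 2 ^ k + 2 ^ k * of_bool (odd (a div 2 ^ k)))
      = 2 ^ k - 1 - a mod 2 ^ k + 2 ^ k * of_bool (even (a div 2 ^ k))" for a :: nat
  proof -
    \<comment> \<open>Taking a number from a word of all ones never borrows, so the top digit is
      complemented separately from the rest.\<close>
    have "m < q \<Longrightarrow> 2 * q - 1 - (m + q * of_bool (\<not> b)) = q - 1 - m + q * of_bool b" for m q :: nat and b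
      by (cases b) auto
    from this[of "a mod 2 ^ k" "2 ^ k"] show ?thesis by simp
  qed
  show ?thesis
    by (simp only: low_sum_def column_def mod_two_power_Suc compl sum.distrib sum_of_bool_card finite
        distrib_left ac_simps)
qed

lemma carry_0: "carry 0 = card A"
  by (simp add: carry_def low_sum_def)

lemma carry_Suc: "carry (Suc k) = (carry k + column k) div 2"
proof -
  have "carry (Suc k) = (low_sum k + 2 ^ k * column k) div 2 ^ k div 2"
    by (simp only: carry_def low_sum_Suc power_Suc2 div_mult2_eq)
  then show ?thesis by (simp add: carry_def)
qed

lemma column_le: "column k \<le> card A + card B + card C"
  unfolding column_def by (intro add_mono card_mono finite) auto

text \<open>Both the carry and the column sum are at most the number of summands, so half their sum
  is too.\<close>

lemma carry_le: "carry k \<le> card A + card B + card C"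
proof (induction k)
  case (Suc k)
  then show ?case using column_le[of k] by (simp add: carry_Suc)
qed (simp add: carry_0)

text \<open>Once all numbers fit into \<open>k\<close> digits, the reductions modulo 2^k disappear
  and \<open>low_sum k + sum w A = card A * 2^k + sum y B + sum z C\<close>.\<close>

lemma carry_final:
  assumes "\<And>i. i \<in> A \<Longrightarrow> w i < 2 ^ k" "\<And>i. i \<in> B \<Longrightarrow> y i < 2 ^ k" "\<And>i. i \<in> C \<Longrightarrow> z i < 2 ^ k"
  shows "card A \<le> carry k \<longleftrightarrow> sum w A \<le> sum y B + sum z C"
proof -
  have "(\<Sum>i\<in>A. 2 ^ k - 1 - w i mod 2 ^ k) + sum w A = (\<Sum>i\<in>A. 2 ^ k - 1)"
  proof -
    have "2 ^ k - 1 - w i mod 2 ^ k + w i = 2 ^ k - 1" if "i \<in> A" for i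
      using assms(1)[OF that] by simp
    then show ?thesis by (simp flip: sum.distrib)
  qed
  moreover have "card A + (\<Sum>i\<in>A. 2 ^ k - 1) = card A * 2 ^ k"
    by (simp add: algebra_simps)
  moreover have "(\<Sum>i\<in>B. y i mod 2 ^ k) = sum y B" "(\<Sum>i\<in>C. z i mod 2 ^ k) = sum z C"
    using assms(2,3) by (auto intro!: sum.cong)
  ultimately have "low_sum k + sum w A = card A * 2 ^ k + (sum y B + sum z C)"
    by (simp add: low_sum_def)
  moreover have "card A \<le> carry k \<longleftrightarrow> card A * 2 ^ k \<le> low_sum k"
    by (simp add: carry_def less_eq_div_iff_mult_less_eq)
  ultimately show ?thesis by linarith
qed

end

section \<open>Supports as sums over votes\<close>

text \<open>Indices instead of votes, so that equal entries of the profile stay separate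
  summands.\<close>

definition backers :: "profile \<Rightarrow> nat \<Rightarrow> nat \<Rightarrow> nat set" where
  "backers P a b = {v. v < length P \<and> prefers (snd (P ! v)) a b}"

lemma finite_backers [simp]: "finite (backers P a b)"
  by (simp add: backers_def)

lemma card_backers: "card (backers P a b) \<le> length P"
  using card_mono[of "{..<length P}" "backers P a b"] by (auto simp: backers_def)

lemma support_backers: "support P a b = (\<Sum>v\<in>backers P a b. fst (P ! v))"
proof -
  have "support P a b = (\<Sum>v\<in>{..<length P}. if prefers (snd (P ! v)) a b then fst (P ! v) else 0)"
    by (simp add: support_def sum_list_sum_nth case_prod_unfold atLeast0LessThan)
  also have "\<dots> = (\<Sum>v\<in>{v \<in> {..<length P}. prefers (snd (P ! v)) a b}. fst (P ! v))"
    by (rule sum.inter_filter[symmetric]) simp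
  finally show ?thesis by (simp add: backers_def)
qed

text \<open>A vote costs at least four bits: its announcement, a weight, and two for a non-empty
  ranking. A manipulator's weight costs at least two. A vote can back both \<open>b\<close> and the
  preferred candidate, so this is what keeps twice the number of summands within the input
  length.\<close>

lemma length_enc_cwcm:
  assumes "cwcm_instance I"
  shows "4 * length (nonmanipulators I) + 2 * length (weights I) \<le> length (enc_cwcm I)"
proof -
  have nat: "1 \<le> length (enc_nat m)" for m by (simp add: enc_nat_def enc_list_def)
  have "4 * length V \<le> length (items enc_vote V)" if "\<forall>v\<in>set V. snd v \<noteq> []" for V
    using that
  proof (induction V)
    case (Cons v V)
    obtain a r where "snd v = a # r" using Cons.prems by (cases "snd v") auto
    then have "2 \<le> length (enc_list enc_nat (snd v))" by (simp add: enc_list_items)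
    then have "3 \<le> length (enc_vote v)" using nat[of "fst v"] by (simp add: enc_vote_def)
    then show ?case using Cons by simp
  qed simp
  moreover have "\<forall>v\<in>set (nonmanipulators I). snd v \<noteq> []"
    using assms by (fastforce simp: cwcm_instance_def top_truncated_def)
  ultimately have "4 * length (nonmanipulators I) \<le> length (items enc_vote (nonmanipulators I))" by blast
  moreover have "2 * length T \<le> length (items enc_nat T)" for T
  proof (induction T)
    case (Cons m T)
    then show ?case using nat[of m] by simp
  qed simp
  from this[of "weights I"] have "2 * length (weights I) \<le> length (items enc_nat (weights I))" .
  ultimately show ?thesis by (simp add: enc_cwcm_def enc_list_items)
qed

lemma not_above_iff:
  assumes x: "x = enc_cwcm I" and I: "cwcm_instance I"
    and b: "located x b' (enc_nat b)" and d: "located x d' (enc_nat d)" and c: "located x c' (enc_nat c)"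
  shows "not_above x b' d' c' \<longleftrightarrow> support (nonmanipulators I) b d \<le>
    support (nonmanipulators I) (preferred I) c + sum_list (weights I)"
proof -
  note loc = located_enc_cwcm[OF x]
  let ?V = "nonmanipulators I" and ?T = "weights I"
  let ?A = "backers ?V b d" and ?B = "backers ?V (preferred I) c" and ?C = "{..<length ?T}"
  let ?w = "\<lambda>v. fst (?V ! v)" and ?z = "\<lambda>t. ?T ! t"
  define col where "col = column ?A ?B ?C ?w ?w ?z"
  define car where "car = carry ?A ?B ?C ?w ?w ?z"
  have V: "length ?V < length x" and T: "length ?T < length x"
    using located_length_list[OF loc(2)] located_length_list[OF loc(3)] .
  have supports: "supports x p q v \<longleftrightarrow> v \<in> backers ?V e f"
    if "located x p (enc_nat e)" "located x q (enc_nat f)" for p q v e f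
    using vote_items(1)[OF loc(2), of v]
      prefers_at_iff[OF located_vote(2)[OF vote_items(2)[OF loc(2)]] that, of v]
    by (auto simp: supports_def backers_def)
  have vdigit: "digit x (item skip_vote x (votes_pos x) v) k \<longleftrightarrow> odd (?w v div 2 ^ k)"
    if "v < length ?V" for v k
    using digit_iff[OF located_vote(1)[OF vote_items(2)[OF loc(2) that]]] .
  have wdigit: "has_item skip_nat x (weights_pos x) t \<and> digit x (item skip_nat x (weights_pos x) t) k
      \<longleftrightarrow> t \<in> ?C \<and> odd (?z t div 2 ^ k)" for t k
    using nat_items[OF loc(3), of t] digit_iff[of x _ "?z t"] by auto
  have less: "v \<in> backers ?V e f \<Longrightarrow> v < length ?V" for v e f by (simp add: backers_def)
  have less_x: "v \<in> backers ?V e f \<Longrightarrow> v < length x" for v e f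
    using less V by (blast intro: less_trans)
  have setA: "{v. v < length x \<and> supports x b' d' v \<and> \<not> digit x (item skip_vote x (votes_pos x) v) k}
      = {v \<in> ?A. even (?w v div 2 ^ k)}" for k
    unfolding supports[OF b d] using vdigit less less_x by auto
  have setB: "{v. v < length x \<and> supports x (preferred_pos x) c' v \<and> digit x (item skip_vote x (votes_pos x) v) k}
      = {v \<in> ?B. odd (?w v div 2 ^ k)}" for k
    unfolding supports[OF loc(4) c] using vdigit less less_x by auto
  have setC: "{t. t < length x \<and> has_item skip_nat x (weights_pos x) t \<and> digit x (item skip_nat x (weights_pos x) t) k}
      = {t \<in> ?C. odd (?z t div 2 ^ k)}" for k
    unfolding wdigit using T by auto
  have M: "2 * (card ?A + card ?B + card ?C) \<le> length x"
    using length_enc_cwcm[OF I] card_backers[of ?V b d] card_backers[of ?V "preferred I" c]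
    unfolding x by simp
  \<comment> \<open>Carry and column sum are each at most the number of summands, which by
    \<open>M\<close> is at most half the input length.\<close>
  have bound: "car k + col k \<le> Suc (length x)" for k
    using carry_le[of ?A ?B ?C ?w ?w ?z k] column_le[of ?A ?B ?C ?w ?w ?z k] M
    by (simp add: car_def col_def)
  have nxt: "next_carry x b' d' c' k (car k) = car (Suc k)" for k
  proof -
    \<comment> \<open>Intermediate totals after the manipulators and after the backers of the
      preferred candidate. Both are below the final total, so \<open>bound\<close> rules out
      saturation in all three tallies.\<close>
    define m where "m = car k + card {t \<in> ?C. odd (?z t div 2 ^ k)}"
    define m' where "m' = m + card {v \<in> ?B. odd (?w v div 2 ^ k)}"
    have sum: "m' + card {v \<in> ?A. even (?w v div 2 ^ k)} = car k + col k"
      by (simp add: m_def m'_def col_def column_def)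
    have 1: "tally x (length x) (\<lambda>t. has_item skip_nat x (weights_pos x) t \<and>
        digit x (item skip_nat x (weights_pos x) t) k) (car k) = m"
      unfolding m_def using sum bound[of k] by (subst tally_eq; unfold setC; simp add: m_def m'_def)
    have 2: "tally x (length x) (\<lambda>v. supports x (preferred_pos x) c' v \<and>
        digit x (item skip_vote x (votes_pos x) v) k) m = m'"
      unfolding m'_def using sum bound[of k] by (subst tally_eq; unfold setB; simp add: m'_def)
    have 3: "tally x (length x) (\<lambda>v. supports x b' d' v \<and>
        \<not> digit x (item skip_vote x (votes_pos x) v) k) m' = car k + col k"
      using sum bound[of k] by (subst tally_eq; unfold setA; simp)
    show ?thesis
      unfolding next_carry_def 1 2 3 half_eq[OF bound]
      by (simp add: car_def col_def carry_Suc)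
  qed
  have init: "initial_carry x b' d' = card ?A"
  proof -
    have set: "{v. v < length x \<and> supports x b' d' v} = ?A"
      unfolding supports[OF b d] using less_x by auto
    have "card ?A \<le> Suc (length x)" using M by simp
    then show ?thesis unfolding initial_carry_def by (subst tally_eq; unfold set; simp)
  qed
  have car_0: "car 0 = card ?A" by (simp add: car_def carry_0)
  have "iter (\<lambda>j. next_carry x b' d' c' (length x - 1 - j)) (length x) (initial_carry x b' d') = car (length x)"
    by (rule iter_invariant[where P = "\<lambda>k a. a = car k"]) (simp_all add: nxt init car_0)
  then have "not_above x b' d' c' \<longleftrightarrow> card ?A \<le> car (length x)"
    by (simp add: not_above_def init)
  also have "\<dots> \<longleftrightarrow> sum ?w ?A \<le> sum ?w ?B + sum ?z ?C"
    unfolding car_def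
  proof (rule carry_final)
    show "?w v < 2 ^ length x" if "v \<in> ?A" for v
      using located_less_two_power[OF located_vote(1)[OF vote_items(2)[OF loc(2) less[OF that]]]] .
    show "?w v < 2 ^ length x" if "v \<in> ?B" for v
      using located_less_two_power[OF located_vote(1)[OF vote_items(2)[OF loc(2) less[OF that]]]] .
    show "?z t < 2 ^ length x" if "t \<in> ?C" for t
      using located_less_two_power[OF nat_items(2)[OF loc(3)]] that by simp
  qed simp_all
  finally show ?thesis
    by (simp add: support_backers sum_list_sum_nth atLeast0LessThan)
qed

lemma preferred_wins_iff:
  assumes x: "x = enc_cwcm I" and I: "cwcm_instance I"
  shows "preferred_wins x \<longleftrightarrow> (\<forall>b\<in>set (candidates I). \<forall>c\<in>set (candidates I).
    b \<noteq> preferred I \<and> c \<noteq> preferred I \<longrightarrow> (\<exists>d\<in>set (candidates I). d \<noteq> b \<and>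
      support (nonmanipulators I) b d \<le> support (nonmanipulators I) (preferred I) c + sum_list (weights I)))"
proof -
  note loc = located_enc_cwcm[OF x]
  let ?C = "candidates I"
  let ?i = "item skip_nat x 1"
  note it = nat_items[OF loc(1)]
  have len: "length ?C < length x" by (rule located_length_list[OF loc(1)])
  have "preferred_wins x \<longleftrightarrow> (\<forall>i<length ?C. \<forall>j<length ?C.
     \<not> same x (?i i) (preferred_pos x) \<and> \<not> same x (?i j) (preferred_pos x) \<longrightarrow>
     (\<exists>l<length ?C. \<not> same x (?i l) (?i i) \<and> not_above x (?i i) (?i l) (?i j)))"
    unfolding preferred_wins_def ex_item[OF parses_skip_nat loc(1)] it(1)
    using len by (meson less_trans)
  also have "\<dots> \<longleftrightarrow> (\<forall>i<length ?C. \<forall>j<length ?C. ?C ! i \<noteq> preferred I \<and> ?C ! j \<noteq> preferred I \<longrightarrow>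
     (\<exists>l<length ?C. ?C ! l \<noteq> ?C ! i \<and> support (nonmanipulators I) (?C ! i) (?C ! l) \<le>
        support (nonmanipulators I) (preferred I) (?C ! j) + sum_list (weights I)))"
    using same_iff[OF it(2) loc(4)] same_iff[OF it(2) it(2)] not_above_iff[OF x I it(2) it(2) it(2)]
    by (simp del: One_nat_def cong: conj_cong)
  also have "\<dots> \<longleftrightarrow> (\<forall>b\<in>set ?C. \<forall>c\<in>set ?C.
    b \<noteq> preferred I \<and> c \<noteq> preferred I \<longrightarrow> (\<exists>d\<in>set ?C. d \<noteq> b \<and>
      support (nonmanipulators I) b d \<le> support (nonmanipulators I) (preferred I) c + sum_list (weights I)))"
  proof -
    have "(\<exists>d\<in>set ?C. Q d) \<longleftrightarrow> (\<exists>l<length ?C. Q (?C ! l))" for Q by (metis in_set_conv_nth)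
    then show ?thesis by (simp add: all_set_conv_all_nth)
  qed
  finally show ?thesis .
qed

section \<open>From manipulation to the criterion on supports\<close>

text \<open>One minimum is at most another iff each value of the second is matched by some value of
  the first that is no larger. A rival \<open>b\<close> and \<open>p\<close> witness that both
  minima range over non-empty sets; with \<open>p\<close> as the only candidate the right side holds
  vacuously and the unspecified score is compared only with itself.\<close>

lemma maximin_winners_iff:
  assumes "finite C" "p \<in> C"
  shows "p \<in> maximin_winners C P \<longleftrightarrow>
    (\<forall>b\<in>C. \<forall>c\<in>C. b \<noteq> p \<and> c \<noteq> p \<longrightarrow> (\<exists>d\<in>C. d \<noteq> b \<and> support P b d \<le> support P p c))"
proof -
  have "maximin_score C P b \<le> maximin_score C P p \<longleftrightarrow>
      (\<forall>c\<in>C - {p}. \<exists>d\<in>C - {b}. support P b d \<le> support P p c)" if "b \<in> C" "b \<noteq> p" for b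
  proof -
    have "C - {b} \<noteq> {}" "C - {p} \<noteq> {}" using assms that by auto
    then show ?thesis using assms(1) by (simp add: maximin_score_def Min_le_iff)
  qed
  then have "p \<in> maximin_winners C P \<longleftrightarrow>
      (\<forall>b\<in>C. b \<noteq> p \<longrightarrow> (\<forall>c\<in>C - {p}. \<exists>d\<in>C - {b}. support P b d \<le> support P p c))"
    using assms(2) unfolding maximin_winners_def by fastforce
  then show ?thesis by blast
qed

lemma support_append: "support (P @ Q) a b = support P a b + support Q a b"
  by (simp add: support_def)

lemma support_zip_le: "support (zip ws rs) a b \<le> sum_list ws"
proof (induction ws arbitrary: rs)
  case (Cons w ws)
  then show ?case by (cases rs) (auto simp: support_def intro: add_mono le_SucI trans_le_add2)
qed (simp add: support_def)

lemma prefers_singleton: "prefers [p] a b \<longleftrightarrow> a = p \<and> b \<noteq> p"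
  by (auto simp: prefers_def)

lemma support_zip_singleton:
  "support (zip ws (replicate (length ws) [p])) a b = (if a = p \<and> b \<noteq> p then sum_list ws else 0)"
  by (induction ws) (auto simp: support_def prefers_singleton)

lemma maximin_manipulable_iff:
  assumes I: "cwcm_instance I"
  shows "maximin_manipulable I \<longleftrightarrow> (\<forall>b\<in>set (candidates I). \<forall>c\<in>set (candidates I).
    b \<noteq> preferred I \<and> c \<noteq> preferred I \<longrightarrow> (\<exists>d\<in>set (candidates I). d \<noteq> b \<and>
      support (nonmanipulators I) b d \<le> support (nonmanipulators I) (preferred I) c + sum_list (weights I)))"
    (is "_ \<longleftrightarrow> ?R")
proof -
  let ?C = "set (candidates I)" and ?p = "preferred I" and ?S = "nonmanipulators I"
  have p: "?p \<in> ?C" using I by (simp add: cwcm_instance_def)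
  note wins = maximin_winners_iff[OF finite_set p]
  show ?thesis
  proof
    assume "maximin_manipulable I"
    then obtain rs where "?p \<in> maximin_winners ?C (?S @ zip (weights I) rs)"
      by (auto simp: maximin_manipulable_def)
    then have W: "\<forall>b\<in>?C. \<forall>c\<in>?C. b \<noteq> ?p \<and> c \<noteq> ?p \<longrightarrow> (\<exists>d\<in>?C. d \<noteq> b \<and>
        support ?S b d + support (zip (weights I) rs) b d \<le> support ?S ?p c + support (zip (weights I) rs) ?p c)"
      by (simp only: wins support_append)
    \<comment> \<open>On the side of \<open>b\<close> the manipulators' non-negative share is
      dropped; on the side of \<open>p\<close> it is replaced by their total weight.\<close>
    have "support ?S b d \<le> support ?S ?p c + sum_list (weights I)"
      if "support ?S b d + support (zip (weights I) rs) b d \<le> support ?S ?p c + support (zip (weights I) rs) ?p c"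
      for b c d using that support_zip_le[of "weights I" rs ?p c] by linarith
    then show ?R using W by blast
  next
    assume R: ?R
    let ?rs = "replicate (length (weights I)) [?p]"
    have "?p \<in> maximin_winners ?C (?S @ zip (weights I) ?rs)"
      unfolding wins support_append support_zip_singleton using R by auto
    moreover have "\<forall>r\<in>set ?rs. top_truncated ?C r" using p by (auto simp: top_truncated_def)
    ultimately show "maximin_manipulable I" unfolding maximin_manipulable_def by (metis length_replicate)
  qed
qed

theorem theorem11: "CWCM_maximin \<in> PTIME"
proof (rule decidable_PTIME)
  \<comment> \<open>\<open>well_formed\<close> supplies an encoded instance;
    \<open>valid_instance\<close> then supplies the hypothesis under which
    \<open>preferred_wins\<close> is known to be correct.\<close>
  have "x \<in> CWCM_maximin \<longleftrightarrow> well_formed x \<and> valid_instance x \<and> preferred_wins x" for x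
    using well_formed_iff valid_instance_iff preferred_wins_iff maximin_manipulable_iff
    unfolding CWCM_maximin_def by (auto simp: image_iff)
  then show "decidable 0 (\<lambda>x s. x \<in> CWCM_maximin)"
    by (simp only:) (intro decidable_conj decidable_well_formed decidable_valid_instance decidable_preferred_wins)
qed

end
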